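(* Let $\mathcal{R}=\mathbb{C}[\partial]A\oplus\mathbb{C}[\partial]B$ be the rank two Lie conformal algebra of Type I, let $V_{\alpha,\beta,\phi}=\mathbb{C}[\partial]v$ be a nontrivial finite irreducible $\mathcal{R}$-module and let $\eta\in\mathbb{C}$. Consider extensions of $\mathcal{R}$-modules of the form $$0\longrightarrow V_{\alpha,\beta,\phi}\longrightarrow E\longrightarrow\mathbb{C}c_\eta\longrightarrow0 .\qquad(\ast)$$ Every such $E$ is, as a vector space, $\mathbb{C}[\partial]v\oplus\mathbb{C}c_\eta$ with $$A_\lambda v=\delta_1(\partial+\alpha\lambda+\beta)v,\quad B_\lambda v=\delta_2\phi(\lambda)v,\quad A_\lambda c_\eta=f(\partial,\lambda)v,\quad B_\lambda c_\eta=g(\partial,\lambda)v,\quad\partial c_\eta=\eta c_\eta+h(\partial)v\qquad(\ast\ast)$$ for some $f,g\in\mathbb{C}[\partial,\lambda]$, $h\in\mathbb{C}[\partial]$. Nontrivial extensions of the form $(\ast)$ exist only when $\delta_1=1$, $\alpha=1$, $\beta+\eta=0$. Moreover, in this case the space $\mathrm{Ext}(\mathbb{C}c_\eta,V_{\alpha,\beta,\phi})$ is $1$-dimensional, and the unique (up to a scalar) nontrivial extension is given (up to equivalence) by $(\ast\ast)$ with $\delta_2=0$, $g(\partial,\lambda)=0$ and $f(\partial,\lambda)=h(\partial)=s$ with a nonzero constant $s$.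
   Context: Everything is over $\mathbb{C}$. A Lie conformal algebra $\mathcal{R}$ is a $\mathbb{C}[\partial]$-module with a $\mathbb{C}$-linear $\lambda$-bracket $\mathcal{R}\otimes\mathcal{R}\to\mathcal{R}[\lambda]$, $a\otimes b\mapsto[a_\lambda b]$, satisfying $[\partial a_\lambda b]=-\lambda[a_\lambda b]$, $[a_\lambda\partial b]=(\partial+\lambda)[a_\lambda b]$, $[a_\lambda b]=-[b_{-\lambda-\partial}a]$ and $[a_\lambda[b_\mu c]]=[[a_\lambda b]_{\lambda+\mu}c]+[b_\mu[a_\lambda c]]$. A conformal $\mathcal{R}$-module $V$ is a $\mathbb{C}[\partial]$-module with a $\mathbb{C}$-linear map $\mathcal{R}\otimes V\to V[\lambda]$, $a\otimes v\mapsto a_\lambda v$, satisfying $(\partial a)_\lambda v=-\lambda(a_\lambda v)$, $a_\lambda(\partial v)=(\partial+\lambda)a_\lambda v$, $a_\lambda(b_\mu v)=[a_\lambda b]_{\lambda+\mu}v+b_\mu(a_\lambda v)$. For $\eta\in\mathbb{C}$, $\mathbb{C}c_\eta$ is the one-dimensional module with $\partial c_\eta=\eta c_\eta$ and $\mathcal{R}_\lambda c_\eta=0$. An extension of $W$ by $V$ is an exact sequence of modules $0\to V\to E\to W\to0$. Two extensions $E,E'$ are equivalent if there is a module homomorphism $E\to E'$ compatible with the identity maps of $V$ and $W$. An extension is trivial if it is equivalent to $V\oplus W$. $\mathrm{Ext}(W,V)$ is the vector space of extension cocycles modulo those equivalent to the trivial extension. The Lie conformal algebra of Type I is the direct sum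 of the Virasoro conformal algebra and a rank one commutative one: it has free basis $\{A,B\}$ over $\mathbb{C}[\partial]$ with $[A_\lambda A]=(\partial+2\lambda)A$, $[A_\lambda B]=0$, $[B_\lambda B]=0$. Its nontrivial finite irreducible modules are $V_{\alpha,\beta,\phi}=\mathbb{C}[\partial]v$ (free of rank one) with $A_\lambda v=\delta_1(\partial+\alpha\lambda+\beta)v$, $B_\lambda v=\delta_2\phi(\lambda)v$, where $\delta_1,\delta_2\in\{0,1\}$, $\delta_1^2+\delta_2^2=1$, $\beta\in\mathbb{C}$, $0\neq\alpha\in\mathbb{C}$, and $\phi\in\mathbb{C}[\lambda]$ is a nonzero polynomial. *)

theory Defs
  imports "HOL-Computational_Algebra.Polynomial" "HOL-Library.Product_Plus"
    "HOL-Algebra.AbelCoset" "Jordan_Normal_Form.VS_Connect"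
begin

section \<open>Modules over the polynomial ring in the derivation\<close>

text \<open>A \<open>\<complex>[\<partial>]\<close>-module is given by its scalar multiplication by complex numbers and by the
  operator \<open>\<partial>\<close>.  The space \<open>V[\<lambda>]\<close> is \<^typ>\<open>'v poly\<close>: the coefficient of index \<open>i\<close> is the
  coefficient of \<open>\<lambda>^i\<close>, so that \<^term>\<open>pCons 0\<close> is multiplication by \<open>\<lambda>\<close>.\<close>

record 'v dmod =
  scl :: "complex \<Rightarrow> 'v \<Rightarrow> 'v"
  der :: "'v \<Rightarrow> 'v"

definition dmodule :: "('v::ab_group_add, 'm) dmod_scheme \<Rightarrow> bool" where
  "dmodule M \<longleftrightarrow> vector_space (scl M) \<and> Vector_Spaces.linear (scl M) (scl M) (der M)"

text \<open>Scalar multiplication and \<open>\<partial> + \<lambda>\<close> on \<open>V[\<lambda>]\<close>.\<close>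

definition pscl :: "('v::ab_group_add, 'm) dmod_scheme \<Rightarrow> complex \<Rightarrow> 'v poly \<Rightarrow> 'v poly" where
  "pscl M c q = map_poly (scl M c) q"

definition der_lam :: "('v::ab_group_add, 'm) dmod_scheme \<Rightarrow> 'v poly \<Rightarrow> 'v poly" where
  "der_lam M q = map_poly (der M) q + pCons 0 q"

text \<open>The value of an element of \<open>V[\<lambda>]\<close> at a complex number.\<close>

definition at_lam :: "('v::ab_group_add, 'm) dmod_scheme \<Rightarrow> 'v poly \<Rightarrow> complex \<Rightarrow> 'v" where
  "at_lam M q z = (\<Sum>i\<le>degree q. scl M (z ^ i) (coeff q i))"

text \<open>\<open>p(\<partial>) x\<close> for \<open>p \<in> \<complex>[\<partial>]\<close>, and \<open>f(\<partial>, \<lambda>) x \<in> V[\<lambda>]\<close> for \<open>f \<in> \<complex>[\<partial>, \<lambda>]\<close>.  A polynomial in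
  \<open>\<partial>\<close> and \<open>\<lambda>\<close> is a \<^typ>\<open>complex poly poly\<close> with outer variable \<open>\<lambda>\<close> and inner variable \<open>\<partial>\<close>.\<close>

definition dact :: "('v::ab_group_add, 'm) dmod_scheme \<Rightarrow> complex poly \<Rightarrow> 'v \<Rightarrow> 'v" where
  "dact M p x = (\<Sum>i\<le>degree p. scl M (coeff p i) ((der M ^^ i) x))"

definition dlact :: "('v::ab_group_add, 'm) dmod_scheme \<Rightarrow> complex poly poly \<Rightarrow> 'v \<Rightarrow> 'v poly" where
  "dlact M f x = map_poly (\<lambda>p. dact M p x) f"


section \<open>Lie conformal algebras and conformal modules\<close>

record (overloaded) 'r lca = "'r dmod" +
  brk :: "'r \<Rightarrow> 'r \<Rightarrow> 'r poly"

record (overloaded) ('r, 'v) cmod = "'v dmod" +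
  act :: "'r \<Rightarrow> 'v \<Rightarrow> 'v poly"

text \<open>The identities in two variables \<open>\<lambda>\<close> and \<open>\<mu>\<close> (Jacobi identity and module identity) are
  identities in \<open>V[\<lambda>, \<mu>]\<close>; they are stated for all complex values of \<open>\<lambda>\<close> and \<open>\<mu>\<close>.  This amounts to
  the same because the ground field is infinite, see the lemma \<open>at_lam_eq_iff\<close>.\<close>

lemma at_lam_eq_iff:
  fixes M :: "('v::ab_group_add, 'm) dmod_scheme"
  assumes "dmodule M"
  shows "(\<forall>z. at_lam M p z = at_lam M q z) \<longleftrightarrow> p = q"
proof -
  interpret vector_space "scl M" using assms by (simp add: dmodule_def)
  have zero: "\<forall>i\<le>n. c i = 0" if "\<And>z. (\<Sum>i\<le>n. scl M (z ^ i) (c i)) = 0" for c n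
    using that
  proof (induction n arbitrary: c)
    case 0
    from 0[of 1] show ?case by simp
  next
    case (Suc n)
    have "(\<Sum>i\<le>n. scl M (z ^ i) (scl M (2 ^ i - 2 ^ Suc n) (c i))) = 0" for z
    proof -
      have "(\<Sum>i\<le>Suc n. scl M (z ^ i) (scl M (2 ^ i - 2 ^ Suc n) (c i))) =
        (\<Sum>i\<le>Suc n. scl M ((2 * z) ^ i) (c i) - scl M (2 ^ Suc n) (scl M (z ^ i) (c i)))"
        by (intro sum.cong refl)
          (simp add: power_mult_distrib scale_left_diff_distrib scale_right_diff_distrib right_diff_distrib mult_ac)
      also have "\<dots> = (\<Sum>i\<le>Suc n. scl M ((2 * z) ^ i) (c i)) -
          scl M (2 ^ Suc n) (\<Sum>i\<le>Suc n. scl M (z ^ i) (c i))"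
        by (simp only: sum_subtractf scale_sum_right)
      also have "\<dots> = 0"
        by (simp only: Suc.prems scale_zero_right diff_zero)
      finally show ?thesis by simp
    qed
    from Suc.IH[OF this] have *: "scl M (2 ^ i - 2 ^ Suc n) (c i) = 0" if "i \<le> n" for i
      using that by blast
    have low: "c i = 0" if "i \<le> n" for i
    proof -
      have "(2::nat) ^ i \<noteq> 2 ^ Suc n"
        using that by (simp only: power_inject_exp)
      hence "(2::complex) ^ i \<noteq> 2 ^ Suc n"
        by (metis of_nat_eq_iff of_nat_numeral of_nat_power)
      with *[OF that] show ?thesis by simp
    qed
    moreover have "c (Suc n) = 0"
      using Suc.prems[of 1] low by simp
    ultimately show ?case by (simp add: le_Suc_eq)
  qed
  have ext: "at_lam M r z = (\<Sum>i\<le>n. scl M (z ^ i) (coeff r i))" if "degree r \<le> n" for r z n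
    unfolding at_lam_def
    by (rule sum.mono_neutral_left) (use that in \<open>auto simp: coeff_eq_0\<close>)
  show ?thesis
  proof (intro iffI)
    assume *: "\<forall>z. at_lam M p z = at_lam M q z"
    define n where "n = max (degree p) (degree q)"
    have "(\<Sum>i\<le>n. scl M (z ^ i) (coeff p i - coeff q i)) = 0" for z
      using *[rule_format, of z] ext[of p n z] ext[of q n z]
      by (simp add: n_def scale_right_diff_distrib sum_subtractf)
    from zero[OF this] have "coeff p i = coeff q i" if "i \<le> n" for i
      using that by auto
    moreover have "coeff p i = coeff q i" if "\<not> i \<le> n" for i
      using that by (simp add: n_def coeff_eq_0)
    ultimately show "p = q" by (intro poly_eqI) blast
  qed simp
qed

definition lie_conformal_algebra :: "'r::ab_group_add lca \<Rightarrow> bool" where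
  "lie_conformal_algebra R \<longleftrightarrow> dmodule R \<and>
    (\<forall>b. Vector_Spaces.linear (scl R) (pscl R) (\<lambda>a. brk R a b)) \<and>
    (\<forall>a. Vector_Spaces.linear (scl R) (pscl R) (brk R a)) \<and>
    (\<forall>a b. brk R (der R a) b = - pCons 0 (brk R a b)) \<and>
    (\<forall>a b. brk R a (der R b) = der_lam R (brk R a b)) \<and>
    (\<forall>a b. brk R a b =
      - (\<Sum>i\<le>degree (brk R b a). ((\<lambda>q. - der_lam R q) ^^ i) [:coeff (brk R b a) i:])) \<and>
    (\<forall>a b c l m.
      at_lam R (brk R a (at_lam R (brk R b c) m)) l =
      at_lam R (brk R (at_lam R (brk R a b) l) c) (l + m) +
      at_lam R (brk R b (at_lam R (brk R a c) l)) m)"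

definition conformal_module ::
    "'r::ab_group_add lca \<Rightarrow> ('r, 'v::ab_group_add) cmod \<Rightarrow> bool" where
  "conformal_module R V \<longleftrightarrow> dmodule V \<and>
    (\<forall>x. Vector_Spaces.linear (scl R) (pscl V) (\<lambda>a. act V a x)) \<and>
    (\<forall>a. Vector_Spaces.linear (scl V) (pscl V) (act V a)) \<and>
    (\<forall>a x. act V (der R a) x = - pCons 0 (act V a x)) \<and>
    (\<forall>a x. act V a (der V x) = der_lam V (act V a x)) \<and>
    (\<forall>a b x l m.
      at_lam V (act V a (at_lam V (act V b x) m)) l =
      at_lam V (act V (at_lam R (brk R a b) l) x) (l + m) +
      at_lam V (act V b (at_lam V (act V a x) l)) m)"

definition conformal_hom ::
    "('r, 'v::ab_group_add) cmod \<Rightarrow> ('r, 'w::ab_group_add) cmod \<Rightarrow> ('v \<Rightarrow> 'w) \<Rightarrow> bool" where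
  "conformal_hom V W \<phi> \<longleftrightarrow> Vector_Spaces.linear (scl V) (scl W) \<phi> \<and>
    (\<forall>x. \<phi> (der V x) = der W (\<phi> x)) \<and>
    (\<forall>a x. map_poly \<phi> (act V a x) = act W a (\<phi> x))"


section \<open>Extensions\<close>

text \<open>The extension \<open>0 \<rightarrow> V \<rightarrow> E \<rightarrow> W \<rightarrow> 0\<close> with maps \<open>\<iota> : V \<rightarrow> E\<close> and \<open>\<pi> : E \<rightarrow> W\<close>.\<close>

definition extension ::
    "'r::ab_group_add lca \<Rightarrow> ('r, 'v::ab_group_add) cmod \<Rightarrow> ('r, 'w::ab_group_add) cmod \<Rightarrow>
     ('r, 'e::ab_group_add) cmod \<Rightarrow> ('v \<Rightarrow> 'e) \<Rightarrow> ('e \<Rightarrow> 'w) \<Rightarrow> bool" where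
  "extension R V W E \<iota> \<pi> \<longleftrightarrow>
    conformal_module R V \<and> conformal_module R W \<and> conformal_module R E \<and>
    conformal_hom V E \<iota> \<and> conformal_hom E W \<pi> \<and>
    inj \<iota> \<and> range \<iota> = {e. \<pi> e = 0} \<and> surj \<pi>"

definition ext_equivalent ::
    "('r, 'e::ab_group_add) cmod \<Rightarrow> ('v \<Rightarrow> 'e) \<Rightarrow> ('e \<Rightarrow> 'w) \<Rightarrow>
     ('r, 'd::ab_group_add) cmod \<Rightarrow> ('v \<Rightarrow> 'd) \<Rightarrow> ('d \<Rightarrow> 'w) \<Rightarrow> bool" where
  "ext_equivalent E \<iota> \<pi> E' \<iota>' \<pi>' \<longleftrightarrow>
    (\<exists>\<phi>. conformal_hom E E' \<phi> \<and> \<phi> \<circ> \<iota> = \<iota>' \<and> \<pi>' \<circ> \<phi> = \<pi>)"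

definition poly_pair :: "'v::ab_group_add poly \<Rightarrow> 'w::ab_group_add poly \<Rightarrow> ('v \<times> 'w) poly" where
  "poly_pair p q = map_poly (\<lambda>x. (x, 0)) p + map_poly (\<lambda>w. (0, w)) q"

definition direct_sum_mod ::
    "('r, 'v::ab_group_add) cmod \<Rightarrow> ('r, 'w::ab_group_add) cmod \<Rightarrow> ('r, 'v \<times> 'w) cmod" where
  "direct_sum_mod V W =
    \<lparr>scl = (\<lambda>c (x, w). (scl V c x, scl W c w)),
     der = (\<lambda>(x, w). (der V x, der W w)),
     act = (\<lambda>a (x, w). poly_pair (act V a x) (act W a w))\<rparr>"

definition ext_in :: "'v \<Rightarrow> 'v \<times> 'w::zero" where
  "ext_in x = (x, 0)"

definition trivial_extension ::
    "('r, 'v::ab_group_add) cmod \<Rightarrow> ('r, 'w::ab_group_add) cmod \<Rightarrow>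
     ('r, 'e::ab_group_add) cmod \<Rightarrow> ('v \<Rightarrow> 'e) \<Rightarrow> ('e \<Rightarrow> 'w) \<Rightarrow> bool" where
  "trivial_extension V W E \<iota> \<pi> \<longleftrightarrow> ext_equivalent E \<iota> \<pi> (direct_sum_mod V W) ext_in snd"

text \<open>Splitting an extension as a vector space, \<open>E = V \<oplus> W\<close>, the module structure of \<open>E\<close> is
  \<open>\<partial> w = \<partial>\<^sub>W w + \<theta>(w)\<close> and \<open>a\<^sub>\<lambda> w = (a\<^sub>\<lambda> w)\<^sub>W + \<psi>(a, w)\<close> with \<open>\<theta>(w) \<in> V\<close> and \<open>\<psi>(a, w) \<in> V[\<lambda>]\<close>.
  The extension cocycles are the pairs \<open>(\<theta>, \<psi>)\<close> for which this is a conformal module.\<close>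

type_synonym ('r, 'w, 'v) cochain = "('w \<Rightarrow> 'v) \<times> ('r \<Rightarrow> 'w \<Rightarrow> 'v poly)"

definition ext_of ::
    "('r, 'v::ab_group_add) cmod \<Rightarrow> ('r, 'w::ab_group_add) cmod \<Rightarrow> ('r, 'w, 'v) cochain \<Rightarrow>
     ('r, 'v \<times> 'w) cmod" where
  "ext_of V W z =
    \<lparr>scl = (\<lambda>c (x, w). (scl V c x, scl W c w)),
     der = (\<lambda>(x, w). (der V x + fst z w, der W w)),
     act = (\<lambda>a (x, w). poly_pair (act V a x + snd z a w) (act W a w))\<rparr>"

definition cocycles ::
    "'r::ab_group_add lca \<Rightarrow> ('r, 'w::ab_group_add) cmod \<Rightarrow> ('r, 'v::ab_group_add) cmod \<Rightarrow>
     ('r, 'w, 'v) cochain set" where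
  "cocycles R W V = {z. conformal_module R (ext_of V W z)}"

definition trivial_cocycles ::
    "'r::ab_group_add lca \<Rightarrow> ('r, 'w::ab_group_add) cmod \<Rightarrow> ('r, 'v::ab_group_add) cmod \<Rightarrow>
     ('r, 'w, 'v) cochain set" where
  "trivial_cocycles R W V =
    {z \<in> cocycles R W V. trivial_extension V W (ext_of V W z) ext_in snd}"

definition cochain_scale ::
    "('r, 'v::ab_group_add) cmod \<Rightarrow> complex \<Rightarrow> ('r, 'w, 'v) cochain \<Rightarrow> ('r, 'w, 'v) cochain" where
  "cochain_scale V k z = (\<lambda>w. scl V k (fst z w), \<lambda>a w. pscl V k (snd z a w))"

text \<open>The vector space of cocycles and its quotient by the trivial ones.  The fields
  \<open>mult\<close> and \<open>one\<close> of the record of modules play no role.\<close>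

definition cocycle_space ::
    "'r::ab_group_add lca \<Rightarrow> ('r, 'w::ab_group_add) cmod \<Rightarrow> ('r, 'v::ab_group_add) cmod \<Rightarrow>
     (complex, ('r, 'w, 'v) cochain) module" where
  "cocycle_space R W V =
    \<lparr>carrier = cocycles R W V, mult = undefined, one = undefined,
     zero = (\<lambda>_. 0, \<lambda>_ _. 0),
     add = (\<lambda>y z. (\<lambda>w. fst y w + fst z w, \<lambda>a w. snd y a w + snd z a w)),
     smult = cochain_scale V\<rparr>"

definition Ext ::
    "'r::ab_group_add lca \<Rightarrow> ('r, 'w::ab_group_add) cmod \<Rightarrow> ('r, 'v::ab_group_add) cmod \<Rightarrow>
     (complex, ('r, 'w, 'v) cochain set) module" where
  "Ext R W V =
    (let Z = cocycle_space R W V; T = trivial_cocycles R W V in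
      \<lparr>carrier = a_rcosets\<^bsub>Z\<^esub> T, mult = undefined, one = undefined,
       zero = T, add = set_add Z,
       smult = (\<lambda>k X. \<Union>z\<in>X. T +>\<^bsub>Z\<^esub> cochain_scale V k z)\<rparr>)"


section \<open>The algebra of Type I and its modules\<close>

definition type_I :: "'r::ab_group_add lca \<Rightarrow> 'r \<Rightarrow> 'r \<Rightarrow> bool" where
  "type_I R A B \<longleftrightarrow> lie_conformal_algebra R \<and>
    (\<forall>r. \<exists>!pq. r = dact R (fst pq) A + dact R (snd pq) B) \<and>
    brk R A A = [:der R A, scl R 2 A:] \<and> brk R A B = 0 \<and> brk R B B = 0"

text \<open>The relations \<open>A\<^sub>\<lambda> v = \<delta>\<^sub>1(\<partial> + \<alpha>\<lambda> + \<beta>)v\<close> and \<open>B\<^sub>\<lambda> v = \<delta>\<^sub>2 \<phi>(\<lambda>)v\<close>.\<close>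

definition rank_one_relations ::
    "('r, 'v::ab_group_add) cmod \<Rightarrow> 'r \<Rightarrow> 'r \<Rightarrow> 'v \<Rightarrow>
     complex \<Rightarrow> complex \<Rightarrow> complex \<Rightarrow> complex \<Rightarrow> complex poly \<Rightarrow> bool" where
  "rank_one_relations V A B v \<delta>1 \<delta>2 \<alpha> \<beta> \<phi> \<longleftrightarrow>
    act V A v = dlact V [:[:\<delta>1 * \<beta>, \<delta>1:], [:\<delta>1 * \<alpha>:]:] v \<and>
    act V B v = dlact V (map_poly (\<lambda>c. [:\<delta>2 * c:]) \<phi>) v"

text \<open>The module \<open>V = \<complex>[\<partial>]v\<close>, free of rank one on \<open>v\<close>; it is irreducible and nontrivial for
  \<open>\<delta>\<^sub>1, \<delta>\<^sub>2 \<in> {0, 1}\<close>, \<open>\<delta>\<^sub>1\<^sup>2 + \<delta>\<^sub>2\<^sup>2 = 1\<close>, \<open>\<alpha> \<noteq> 0\<close>, \<open>\<phi> \<noteq> 0\<close>.\<close>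

definition rank_one_module ::
    "'r::ab_group_add lca \<Rightarrow> 'r \<Rightarrow> 'r \<Rightarrow> ('r, 'v::ab_group_add) cmod \<Rightarrow> 'v \<Rightarrow>
     complex \<Rightarrow> complex \<Rightarrow> complex \<Rightarrow> complex \<Rightarrow> complex poly \<Rightarrow> bool" where
  "rank_one_module R A B V v \<delta>1 \<delta>2 \<alpha> \<beta> \<phi> \<longleftrightarrow> conformal_module R V \<and>
    (\<forall>x. \<exists>!p. x = dact V p v) \<and> rank_one_relations V A B v \<delta>1 \<delta>2 \<alpha> \<beta> \<phi>"

text \<open>The module \<open>\<complex>c\<^sub>\<eta>\<close>; the basis vector \<open>c\<^sub>\<eta>\<close> is the complex number \<open>1\<close>.\<close>

definition one_dim_mod :: "complex \<Rightarrow> ('r, complex) cmod" where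
  "one_dim_mod \<eta> = \<lparr>scl = (*), der = (*) \<eta>, act = (\<lambda>_ _. 0)\<rparr>"

text \<open>The relations in an extension \<open>E\<close> of \<open>\<complex>c\<^sub>\<eta>\<close> by \<open>\<complex>[\<partial>]v\<close>, with \<open>v\<close> identified with its image
  in \<open>E\<close> and \<open>c \<in> E\<close> a lift of \<open>c\<^sub>\<eta>\<close>:
  \<open>A\<^sub>\<lambda> c = f(\<partial>, \<lambda>)v\<close>, \<open>B\<^sub>\<lambda> c = g(\<partial>, \<lambda>)v\<close>, \<open>\<partial> c = \<eta> c + h(\<partial>)v\<close>.\<close>

definition ext_relations ::
    "('r, 'e::ab_group_add) cmod \<Rightarrow> 'r \<Rightarrow> 'r \<Rightarrow> 'e \<Rightarrow> 'e \<Rightarrow>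
     complex \<Rightarrow> complex \<Rightarrow> complex \<Rightarrow> complex \<Rightarrow> complex poly \<Rightarrow> complex \<Rightarrow>
     complex poly poly \<Rightarrow> complex poly poly \<Rightarrow> complex poly \<Rightarrow> bool" where
  "ext_relations E A B v c \<delta>1 \<delta>2 \<alpha> \<beta> \<phi> \<eta> f g h \<longleftrightarrow>
    rank_one_relations E A B v \<delta>1 \<delta>2 \<alpha> \<beta> \<phi> \<and>
    act E A c = dlact E f v \<and> act E B c = dlact E g v \<and>
    der E c = scl E \<eta> c + dact E h v"

end

theory Submission
  imports Defs
begin

text \<open>
Let \<open>c\<close> be a lift of \<open>c\<^sub>\<eta>\<close> to an extension \<open>E\<close>.  Everything is governed by the one element
\<open>h = (\<partial> - \<eta>)c\<close> of \<open>V\<close>.  Moving \<open>a\<^sub>\<lambda>\<close> past \<open>\<partial> - \<eta>\<close> gives \<open>(\<partial> + \<lambda> - \<eta>) (a\<^sub>\<lambda> c) = a\<^sub>\<lambda> h\<close>, and as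
\<open>V\<close> is torsion-free this determines \<open>a\<^sub>\<lambda> c\<close>.  Conversely, if \<open>h\<close> is such that \<open>a\<^sub>\<lambda> h\<close> is divisible by \<open>\<partial> + \<lambda> - \<eta>\<close> for every \<open>a\<close>, then the quotients automatically satisfy
all axioms, the Jacobi identity included, because these hold in \<open>V\<close> after multiplication by
\<open>\<partial> + \<lambda> + \<mu> - \<eta>\<close> (lemma \<open>cocycle_iff\<close>).  A different lift changes \<open>h\<close> by an element of \<open>(\<partial> - \<eta>)V\<close>.
Hence the extensions up to equivalence are the elements \<open>h\<close> with this divisibility property modulo
\<open>(\<partial> - \<eta>)V\<close> (lemma \<open>ext_equivalent_iff\<close>).

For \<open>V = \<complex>[\<partial>]v\<close> the quotient of \<open>V\<close> by \<open>(\<partial> - \<eta>)V\<close> is \<open>\<complex>\<close> through \<open>p(\<partial>)v \<mapsto> p(\<eta>)\<close>, so \<open>Ext\<close> is at most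
one-dimensional and the class of an extension is the number \<open>p(\<eta>)\<close> for \<open>h = p(\<partial>)v\<close> (lemma
\<open>ext_equivalent_iff_ev\<close>).  Divisibility of \<open>a\<^sub>\<lambda> h = p(\<partial> + \<lambda>) (a\<^sub>\<lambda> v)\<close> is tested by substituting
\<open>\<partial> = \<eta> - \<lambda>\<close>.  For \<open>a = A\<close> and \<open>a = B\<close> this gives \<open>\<delta>\<^sub>1 p(\<eta>) (\<beta> + \<eta> + (\<alpha> - 1)\<lambda>) = 0\<close> and
\<open>\<delta>\<^sub>2 p(\<eta>) \<phi>(\<lambda>) = 0\<close>, so that a nonzero class forces \<open>\<delta>\<^sub>2 = 0\<close>, \<open>\<alpha> = 1\<close> and \<open>\<beta> + \<eta> = 0\<close> (lemma
\<open>nonvanishing_class\<close>).  In that case \<open>A\<^sub>\<lambda> v = (\<partial> + \<lambda> - \<eta>)v\<close>, so \<open>h = s v\<close> is admissible with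
\<open>A\<^sub>\<lambda> c = s v\<close> and \<open>B\<^sub>\<lambda> c = 0\<close>, and these represent all classes (lemma \<open>ex_generating_cocycle\<close>).
\<close>


section \<open>Values of polynomials with coefficients in a module\<close>

locale deriv_module =
  fixes M :: "('v::ab_group_add, 'm) dmod_scheme"
  assumes dmodule: "dmodule M"
begin

sublocale vector_space "scl M"
  using dmodule by (simp add: dmodule_def)

lemma der_add: "der M (x + y) = der M x + der M y"
  and der_scl: "der M (scl M c x) = scl M c (der M x)"
  using dmodule by (auto simp: dmodule_def Vector_Spaces.linear_iff)

lemma der_0 [simp]: "der M 0 = 0"
  using der_add[of 0 0] by simp

lemma der_minus: "der M (- x) = - der M x"
  using der_scl[of "-1" x] by simp

lemma der_diff: "der M (x - y) = der M x - der M y"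
  using der_add[of x "- y"] by (simp add: der_minus)

lemma at_lam_bound:
  assumes "degree q \<le> n"
  shows "at_lam M q z = (\<Sum>i\<le>n. scl M (z ^ i) (coeff q i))"
  unfolding at_lam_def
  by (rule sum.mono_neutral_left) (use assms in \<open>auto simp: coeff_eq_0\<close>)

lemma at_lam_0 [simp]: "at_lam M 0 z = 0"
  by (simp add: at_lam_def)

lemma at_lam_pCons: "at_lam M (pCons a q) z = a + scl M z (at_lam M q z)"
proof -
  have "at_lam M (pCons a q) z = (\<Sum>i\<le>Suc (degree q). scl M (z ^ i) (coeff (pCons a q) i))"
    by (rule at_lam_bound) (simp add: degree_pCons_le)
  also have "\<dots> = a + scl M z (at_lam M q z)"
    by (simp add: sum.atMost_Suc_shift at_lam_def scale_sum_right del: sum.atMost_Suc)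
  finally show ?thesis .
qed

lemma at_lam_add: "at_lam M (p + q) z = at_lam M p z + at_lam M q z"
  using at_lam_bound[of p "max (degree p) (degree q)" z]
    at_lam_bound[of q "max (degree p) (degree q)" z]
    at_lam_bound[of "p + q" "max (degree p) (degree q)" z]
  by (simp add: degree_add_le_max scale_right_distrib sum.distrib)

lemma at_lam_minus: "at_lam M (- q) z = - at_lam M q z"
  using at_lam_add[of q "- q" z] by (simp add: eq_neg_iff_add_eq_0 add.commute)

lemma at_lam_eqI: "(\<And>z. at_lam M p z = at_lam M q z) \<Longrightarrow> p = q"
  using at_lam_eq_iff[OF dmodule] by blast

end

lemma at_lam_map_poly:
  assumes "Vector_Spaces.linear (scl M) (scl N) f"
    and "dmodule M" and "dmodule N"
  shows "at_lam N (map_poly f q) z = f (at_lam M q z)"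
proof -
  interpret M: deriv_module M by unfold_locales fact
  interpret N: deriv_module N by unfold_locales fact
  have f: "f (x + y) = f x + f y" "f (scl M c x) = scl N c (f x)" for x y c
    using assms(1) by (auto simp: Vector_Spaces.linear_iff)
  have f0: "f 0 = 0" using f(1)[of 0 0] by simp
  show ?thesis
    by (induction q) (simp_all add: map_poly_pCons f0 f M.at_lam_pCons N.at_lam_pCons)
qed

context deriv_module begin

lemma linear_der: "Vector_Spaces.linear (scl M) (scl M) (der M)"
  using dmodule by (simp add: dmodule_def)

lemma linear_scl: "Vector_Spaces.linear (scl M) (scl M) (scl M c)"
  by (simp add: Vector_Spaces.linear_iff vector_space_axioms scale_right_distrib scale_left_commute)

lemma at_lam_pscl: "at_lam M (pscl M c q) z = scl M c (at_lam M q z)"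
  unfolding pscl_def by (rule at_lam_map_poly[OF linear_scl dmodule dmodule])

lemma at_lam_der_lam: "at_lam M (der_lam M q) z = der M (at_lam M q z) + scl M z (at_lam M q z)"
  by (simp add: der_lam_def at_lam_add at_lam_pCons at_lam_map_poly[OF linear_der dmodule dmodule])

lemma vector_space_pscl: "vector_space (pscl M)"
  by unfold_locales
    (auto intro!: at_lam_eqI simp: at_lam_pscl at_lam_add scale_right_distrib scale_left_distrib)

end


section \<open>Conformal modules, pointwise in the spectral parameter\<close>

text \<open>An identity between elements of \<open>V[\<lambda>]\<close> holds as soon as it holds at every complex value of \<open>\<lambda>\<close>.
Replacing the polynomial \<open>a\<^sub>\<lambda> x\<close> by its values \<open>a\<^sub>l x \<in> V\<close> turns all axioms of a conformal module into
identities in \<open>V\<close> itself, as the Jacobi identity already is.\<close>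

abbreviation act_at :: "('r, 'v::ab_group_add) cmod \<Rightarrow> 'r \<Rightarrow> complex \<Rightarrow> 'v \<Rightarrow> 'v" where
  "act_at V a l x \<equiv> at_lam V (act V a x) l"

lemma conformal_moduleD:
  assumes "conformal_module R V"
  shows "vector_space (scl R)" and "dmodule V"
    and "act_at V (a + b) l x = act_at V a l x + act_at V b l x"
    and "act_at V (scl R k a) l x = scl V k (act_at V a l x)"
    and "act_at V a l (x + y) = act_at V a l x + act_at V a l y"
    and "act_at V a l (scl V k x) = scl V k (act_at V a l x)"
    and "act_at V (der R a) l x = - scl V l (act_at V a l x)"
    and "act_at V a l (der V x) = der V (act_at V a l x) + scl V l (act_at V a l x)"
    and "act_at V a l (act_at V b m x) =
      act_at V (at_lam R (brk R a b) l) (l + m) x + act_at V b m (act_at V a l x)"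
proof -
  show "vector_space (scl R)" and V: "dmodule V"
    using assms by (auto simp: conformal_module_def Vector_Spaces.linear_iff)
  interpret deriv_module V by unfold_locales fact
  have axioms: "act V (a + b) x = act V a x + act V b x" "act V (scl R k a) x = pscl V k (act V a x)"
    "act V a (x + y) = act V a x + act V a y" "act V a (scl V k x) = pscl V k (act V a x)"
    "act V (der R a) x = - pCons 0 (act V a x)" "act V a (der V x) = der_lam V (act V a x)"
    using assms unfolding conformal_module_def Vector_Spaces.linear_iff by blast+
  show "act_at V (a + b) l x = act_at V a l x + act_at V b l x"
    "act_at V (scl R k a) l x = scl V k (act_at V a l x)"
    "act_at V a l (x + y) = act_at V a l x + act_at V a l y"
    "act_at V a l (scl V k x) = scl V k (act_at V a l x)"
    "act_at V (der R a) l x = - scl V l (act_at V a l x)"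
    "act_at V a l (der V x) = der V (act_at V a l x) + scl V l (act_at V a l x)"
    using axioms
    by (simp_all add: at_lam_add at_lam_pscl at_lam_minus at_lam_pCons at_lam_der_lam)
  show "act_at V a l (act_at V b m x) =
      act_at V (at_lam R (brk R a b) l) (l + m) x + act_at V b m (act_at V a l x)"
    using assms unfolding conformal_module_def by blast
qed

lemma conformal_moduleI:
  assumes "vector_space (scl R)" and V: "dmodule V"
    and "\<And>a b l x. act_at V (a + b) l x = act_at V a l x + act_at V b l x"
    and "\<And>k a l x. act_at V (scl R k a) l x = scl V k (act_at V a l x)"
    and "\<And>a l x y. act_at V a l (x + y) = act_at V a l x + act_at V a l y"
    and "\<And>k a l x. act_at V a l (scl V k x) = scl V k (act_at V a l x)"
    and "\<And>a l x. act_at V (der R a) l x = - scl V l (act_at V a l x)"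
    and "\<And>a l x. act_at V a l (der V x) = der V (act_at V a l x) + scl V l (act_at V a l x)"
    and "\<And>a b l m x. act_at V a l (act_at V b m x) =
      act_at V (at_lam R (brk R a b) l) (l + m) x + act_at V b m (act_at V a l x)"
  shows "conformal_module R V"
proof -
  interpret deriv_module V by unfold_locales fact
  show ?thesis
    unfolding conformal_module_def Vector_Spaces.linear_iff
    by (intro conjI allI assms vector_space_pscl vector_space_axioms; (rule at_lam_eqI)?)
      (simp_all only: assms(3-8) at_lam_add at_lam_pscl at_lam_minus at_lam_pCons at_lam_der_lam add_0)
qed

lemma conformal_homI:
  assumes "dmodule V" and "dmodule W" and lin: "Vector_Spaces.linear (scl V) (scl W) \<phi>"
    and "\<And>x. \<phi> (der V x) = der W (\<phi> x)"
    and "\<And>a l x. \<phi> (act_at V a l x) = act_at W a l (\<phi> x)"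
  shows "conformal_hom V W \<phi>"
proof -
  interpret W: deriv_module W by unfold_locales fact
  show ?thesis
    unfolding conformal_hom_def using assms
    by (auto intro!: W.at_lam_eqI simp: at_lam_map_poly[OF lin])
qed

lemma conformal_homD:
  assumes "conformal_hom V W \<phi>"
  shows "\<phi> (x + y) = \<phi> x + \<phi> y" and "\<phi> (scl V k x) = scl W k (\<phi> x)"
    and "\<phi> 0 = 0" and "\<phi> (x - y) = \<phi> x - \<phi> y"
    and "\<phi> (der V x) = der W (\<phi> x)"
    and "dmodule V \<Longrightarrow> dmodule W \<Longrightarrow> \<phi> (act_at V a l x) = act_at W a l (\<phi> x)"
proof -
  have lin: "Vector_Spaces.linear (scl V) (scl W) \<phi>" using assms by (simp add: conformal_hom_def)
  show add: "\<phi> (x + y) = \<phi> x + \<phi> y" for x y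
    using lin by (simp add: Vector_Spaces.linear_iff)
  show "\<phi> (scl V k x) = scl W k (\<phi> x)" using lin by (simp add: Vector_Spaces.linear_iff)
  show "\<phi> 0 = 0" using add[of 0 0] by simp
  show "\<phi> (x - y) = \<phi> x - \<phi> y" using add[of "x - y" y] by (simp add: algebra_simps)
  show "\<phi> (der V x) = der W (\<phi> x)" using assms by (simp add: conformal_hom_def)
  show "\<phi> (act_at V a l x) = act_at W a l (\<phi> x)" if "dmodule V" "dmodule W"
    using at_lam_map_poly[OF lin that, of "act V a x" l] assms by (simp add: conformal_hom_def)
qed


section \<open>Cocycles on a one-dimensional module with values in a torsion-free module\<close>

lemma one_dim_mod_simps [simp]:
  "scl (one_dim_mod \<eta>) = (*)" "der (one_dim_mod \<eta>) = (*) \<eta>" "act (one_dim_mod \<eta>) = (\<lambda>_ _. 0)"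
  by (simp_all add: one_dim_mod_def)

lemma dmodule_one_dim_mod: "dmodule (one_dim_mod \<eta>)"
  by (auto simp: dmodule_def Vector_Spaces.linear_iff vector_space_def algebra_simps)

lemma at_lam_one_dim_mod_0 [simp]: "at_lam (one_dim_mod \<eta>) 0 l = 0"
  by (simp add: at_lam_def)

lemma conformal_module_one_dim_mod:
  "vector_space (scl R) \<Longrightarrow> conformal_module R (one_dim_mod \<eta>)"
  by (rule conformal_moduleI) (simp_all add: dmodule_one_dim_mod)

text \<open>The split extension is the one of the zero cocycle, so that triviality is a case of equivalence with
an extension given by a cocycle.\<close>

lemma direct_sum_mod_eq_ext_of: "direct_sum_mod V W = ext_of V W (\<lambda>_. 0, \<lambda>_ _. 0)"
  by (simp add: direct_sum_mod_def ext_of_def)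

lemma ext_of_simps:
  "scl (ext_of V (one_dim_mod \<eta>) z) k (x, w) = (scl V k x, k * w)"
  "der (ext_of V (one_dim_mod \<eta>) z) (x, w) = (der V x + fst z w, \<eta> * w)"
  "act (ext_of V (one_dim_mod \<eta>) z) a (x, w) = map_poly (\<lambda>x. (x, 0)) (act V a x + snd z a w)"
  by (simp_all add: ext_of_def poly_pair_def)

text \<open>Torsion-freeness says that \<open>\<partial>\<close> has no eigenvectors in \<open>V\<close>, so that every operator \<open>\<partial> - c\<close> can be
cancelled.\<close>

locale torsion_free_module =
  fixes R :: "'r::ab_group_add lca" and V :: "('r, 'v::ab_group_add) cmod" and \<eta> :: complex
  assumes conformal: "conformal_module R V"
    and torsion_free: "der V x = scl V c x \<Longrightarrow> x = 0"
begin

sublocale deriv_module V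
  by unfold_locales (rule conformal_moduleD(2)[OF conformal])

abbreviation W :: "('r, complex) cmod" where "W \<equiv> one_dim_mod \<eta>"

lemmas act_simps = conformal_moduleD(3-8)[OF conformal]

lemma act_0 [simp]: "act_at V a l 0 = 0"
  using act_simps(3)[of a 0 0 l] by simp

lemma act_minus: "act_at V a l (- x) = - act_at V a l x"
  using act_simps(3)[of a x "- x" l] by (simp add: eq_neg_iff_add_eq_0 add.commute)

lemma act_diff: "act_at V a l (x - y) = act_at V a l x - act_at V a l y"
  using act_simps(3)[of a x "- y" l] by (simp add: act_minus)

text \<open>The value at \<open>\<lambda> = c\<close> of the operator \<open>\<partial> + \<lambda> - \<eta>\<close> on \<open>V[\<lambda>]\<close>.  It appears when \<open>a\<^sub>\<lambda>\<close> is moved past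
\<open>\<partial> - \<eta>\<close>, the operator that annihilates \<open>c\<^sub>\<eta>\<close>.\<close>

definition shift :: "complex \<Rightarrow> 'v \<Rightarrow> 'v" where
  "shift c x = der V x + scl V (c - \<eta>) x"

lemma shift_linear:
  "shift c (x + y) = shift c x + shift c y" "shift c (scl V k x) = scl V k (shift c x)"
  "shift c (- x) = - shift c x" "shift c 0 = 0" "shift c (x - y) = shift c x - shift c y"
  by (simp_all add: shift_def der_add der_scl der_minus der_diff scale_right_distrib scale_left_commute
      scale_right_diff_distrib)

lemma shift_inj: "shift c x = shift c y \<longleftrightarrow> x = y"
proof
  assume "shift c x = shift c y"
  then have "shift c (x - y) = 0" by (simp add: shift_linear)
  then have "der V (x - y) = scl V (\<eta> - c) (x - y)"
    by (simp add: shift_def scale_left_diff_distrib add_eq_0_iff2)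
  then have "x - y = 0" by (rule torsion_free)
  then show "x = y" by simp
qed simp

lemma act_shift: "act_at V a l (shift m x) = shift (l + m) (act_at V a l x)"
  by (simp add: shift_def act_simps act_diff algebra_simps)

lemma linear_inl: "Vector_Spaces.linear (scl V) (scl (ext_of V W z)) (\<lambda>x. (x, 0))"
proof -
  have "vector_space (scl (ext_of V W z))"
    by unfold_locales (auto simp: ext_of_simps algebra_simps)
  then show ?thesis
    by (auto simp: Vector_Spaces.linear_iff vector_space_axioms ext_of_simps)
qed

text \<open>A linear map \<open>\<theta>\<close> on \<open>\<complex>\<close> is multiplication by \<open>\<theta>(1)\<close>.\<close>

lemma dmodule_ext_of:
  "dmodule (ext_of V W z) \<longleftrightarrow> (\<forall>w. scl V w (fst z 1) = fst z w)"
proof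
  assume "dmodule (ext_of V W z)"
  then have "scl (ext_of V W z) w (der (ext_of V W z) (0, 1)) =
      der (ext_of V W z) (scl (ext_of V W z) w (0, 1))" for w
    by (auto simp: dmodule_def Vector_Spaces.linear_iff)
  then show "\<forall>w. scl V w (fst z 1) = fst z w"
    by (simp add: ext_of_simps)
next
  assume th: "\<forall>w. scl V w (fst z 1) = fst z w"
  have th': "fst z w = scl V w (fst z 1)" for w using th by metis
  have *: "fst z (w + w') = fst z w + fst z w'" "fst z (k * w) = scl V k (fst z w)" for w w' k
    by (simp_all only: th'[of "w + w'"] th'[of w] th'[of w'] th'[of "k * w"] th'[of 0] scale_left_distrib scale_scale scale_zero_left)
  show "dmodule (ext_of V W z)"
    unfolding dmodule_def
    using linear_inl[of z]
    by (auto simp: Vector_Spaces.linear_iff ext_of_simps * der_add der_scl algebra_simps)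
qed

lemma act_at_ext_of:
  assumes "dmodule (ext_of V W z)"
  shows "act_at (ext_of V W z) a l (x, w) = (act_at V a l x + at_lam V (snd z a w) l, 0)"
  by (simp add: ext_of_simps at_lam_map_poly[OF linear_inl dmodule assms] at_lam_add)

text \<open>Apart from linearity of \<open>\<theta>\<close>, a cocycle \<open>(\<theta>, \<psi>)\<close> only has to satisfy the axiom for \<open>a\<^sub>\<lambda> (\<partial> w)\<close>, which
reads \<open>(\<partial> + \<lambda> - \<eta>) \<psi>(a, w) = a\<^sub>\<lambda> \<theta>(w)\<close>.  All other axioms follow: each of them is an identity for \<open>\<psi>\<close>
which, after applying the injective operator \<open>\<partial> + l - \<eta>\<close> (\<open>\<partial> + l + m - \<eta>\<close> for the Jacobi identity),
becomes the same axiom of the module \<open>V\<close> at the element \<open>\<theta>(w)\<close>.\<close>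

lemma cocycle_iff:
  "z \<in> cocycles R W V \<longleftrightarrow>
    (\<forall>w. scl V w (fst z 1) = fst z w) \<and>
    (\<forall>a w l. shift l (at_lam V (snd z a w) l) = act_at V a l (fst z w))"
proof
  assume "z \<in> cocycles R W V"
  then have E: "conformal_module R (ext_of V W z)" by (simp add: cocycles_def)
  note dE = conformal_moduleD(2)[OF E]
  have th: "\<forall>w. scl V w (fst z 1) = fst z w"
    using dE by (rule iffD1[OF dmodule_ext_of])
  have th': "fst z w = scl V w (fst z 1)" for w using th by metis
  have "fst z 0 = 0" by (simp only: th'[of 0] scale_zero_left)
  have sc: "at_lam V (snd z a (\<eta> * w)) l = scl V \<eta> (at_lam V (snd z a w) l)" for a w l
    using conformal_moduleD(6)[OF E, of a \<eta> "(0, w)" l]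
    by (simp add: ext_of_simps(1) act_at_ext_of[OF dE])
  have "shift l (at_lam V (snd z a w) l) = act_at V a l (fst z w)" for a w l
    using conformal_moduleD(8)[OF E, of a "(0, w)" l] \<open>fst z 0 = 0\<close>
    by (simp add: ext_of_simps(1,2) act_at_ext_of[OF dE] sc shift_def scale_left_diff_distrib add_diff_eq diff_eq_eq)
  with th show "(\<forall>w. scl V w (fst z 1) = fst z w) \<and>
    (\<forall>a w l. shift l (at_lam V (snd z a w) l) = act_at V a l (fst z w))" by blast
next
  assume "(\<forall>w. scl V w (fst z 1) = fst z w) \<and>
    (\<forall>a w l. shift l (at_lam V (snd z a w) l) = act_at V a l (fst z w))"
  then have th: "\<forall>w. scl V w (fst z 1) = fst z w"
    and G: "\<And>a w l. shift l (at_lam V (snd z a w) l) = act_at V a l (fst z w)" by blast+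
  have dE: "dmodule (ext_of V W z)" using th by (rule iffD2[OF dmodule_ext_of])
  have th': "fst z w = scl V w (fst z 1)" for w using th by metis
  have lin: "fst z (w + w') = fst z w + fst z w'" "fst z (k * w) = scl V k (fst z w)" "fst z 0 = 0"
    for w w' k
    by (simp_all only: th'[of "w + w'"] th'[of w] th'[of w'] th'[of "k * w"] th'[of 0] scale_left_distrib scale_scale scale_zero_left)
  define g where "g a l w = at_lam V (snd z a w) l" for a l w
  have shift_g: "shift l (g a l w) = act_at V a l (fst z w)" for a l w
    by (simp add: g_def G)
  \<comment> \<open>Cancelling \<open>\<partial> + l - \<eta>\<close> leaves the corresponding property of the action of \<open>V\<close> at \<open>\<theta>(w)\<close>.\<close>
  have g: "g (a + b) l w = g a l w + g b l w" "g (scl R k a) l w = scl V k (g a l w)"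
    "g a l (w + w') = g a l w + g a l w'" "g a l (k * w) = scl V k (g a l w)"
    "g (der R a) l w = - scl V l (g a l w)" "g a l 0 = 0" for a b l w w' k
    by (subst shift_inj[of l, symmetric], simp add: shift_linear shift_g act_simps lin)+
  have g_der: "act_at V a l (fst z w) + g a l (\<eta> * w) = der V (g a l w) + scl V l (g a l w)" for a l w
    unfolding shift_g[symmetric]
    by (simp add: shift_def g scale_left_diff_distrib)
  then have g_der': "scl V \<eta> (g a l w) + act_at V a l (fst z w) =
      der V (g a l w) + scl V l (g a l w)" for a l w
    by (simp add: g add.commute)
  have g_jac: "act_at V a l (g b m w) =
      g (at_lam R (brk R a b) l) (l + m) w + act_at V b m (g a l w)" for a b l m w
  proof -
    have 1: "shift (l + m) (act_at V a l (g b m w)) = act_at V a l (act_at V b m (fst z w))"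
      by (simp add: act_shift[symmetric] shift_g)
    have 2: "shift (l + m) (act_at V b m (g a l w)) = act_at V b m (act_at V a l (fst z w))"
      by (simp add: act_shift[symmetric] add.commute[of l] shift_g)
    show ?thesis
      by (subst shift_inj[of "l + m", symmetric])
        (simp only: shift_linear(1) 1 2 shift_g conformal_moduleD(9)[OF conformal, of a b _ m l])
  qed
  have jac: "act_at V a l (act_at V b m x + g b m w) =
      act_at V (at_lam R (brk R a b) l) (l + m) x + g (at_lam R (brk R a b) l) (l + m) w +
      act_at V b m (act_at V a l x + g a l w)" for a b l m x w
    by (simp only: act_simps(3) g_jac[of a b m w l] conformal_moduleD(9)[OF conformal, of a b x m l] add_ac)
  have act: "act_at (ext_of V W z) a l (x, w) = (act_at V a l x + g a l w, 0)" for a l x w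
    by (simp add: act_at_ext_of[OF dE] g_def)
  have jac_E: "act_at (ext_of V W z) a l (act_at (ext_of V W z) b m e) =
      act_at (ext_of V W z) (at_lam R (brk R a b) l) (l + m) e +
      act_at (ext_of V W z) b m (act_at (ext_of V W z) a l e)" for a b l m e
    by (cases e) (simp only: act g(6) add_0_right add_Pair jac[of a b _ m _ l])
  have "conformal_module R (ext_of V W z)"
    by (rule conformal_moduleI[OF conformal_moduleD(1)[OF conformal] dE _ _ _ _ _ _ jac_E])
      (auto simp: act ext_of_simps(1,2) act_simps g scale_right_distrib lin der_add g_der' add_ac)
  then show "z \<in> cocycles R W V" by (simp add: cocycles_def)
qed

lemma cocycle_shift:
  "z \<in> cocycles R W V \<Longrightarrow> shift l (at_lam V (snd z a w) l) = act_at V a l (fst z w)"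
  and cocycle_fst: "z \<in> cocycles R W V \<Longrightarrow> fst z w = scl V w (fst z 1)"
  by (metis cocycle_iff)+

text \<open>The component \<open>\<psi>\<close> of a cocycle is a quotient by \<open>\<partial> + \<lambda> - \<eta>\<close>, and such a quotient is unique.  Hence a
cocycle is determined by the single element \<open>\<theta>(1)\<close> of \<open>V\<close>, which occurs if and only if all quotients
exist.\<close>

lemma cocycle_snd_eqI:
  assumes "z \<in> cocycles R W V" and "\<And>l. shift l (at_lam V q l) = act_at V a l (fst z w)"
  shows "snd z a w = q"
  by (rule at_lam_eqI) (metis assms cocycle_shift shift_inj)

lemma cocycle_eqI:
  assumes "y \<in> cocycles R W V" and "z \<in> cocycles R W V" and "fst y 1 = fst z 1"
  shows "y = z"
proof -
  have "fst y w = fst z w" for w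
    using cocycle_fst[OF assms(1), of w] cocycle_fst[OF assms(2), of w] assms(3) by simp
  then show ?thesis
    by (intro prod_eqI ext cocycle_snd_eqI[OF assms(1)]) (simp_all add: cocycle_shift[OF assms(2)])
qed

lemma cocycle_exists:
  assumes "\<And>a. \<exists>q. \<forall>l. shift l (at_lam V q l) = act_at V a l h"
  shows "\<exists>z \<in> cocycles R W V. fst z 1 = h"
proof -
  obtain q where q: "\<And>a l. shift l (at_lam V (q a) l) = act_at V a l h"
    using assms by metis
  let ?z = "(\<lambda>w. scl V w h, \<lambda>a w. pscl V w (q a))"
  have "?z \<in> cocycles R W V"
    by (simp add: cocycle_iff at_lam_pscl shift_linear q act_simps)
  then show ?thesis by (intro bexI[of _ ?z]) simp_all
qed

lemma cocycle_snd_scale: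
  assumes "z \<in> cocycles R W V"
  shows "snd z a w = pscl V w (snd z a 1)"
  by (rule cocycle_snd_eqI[OF assms])
    (simp add: at_lam_pscl shift_linear cocycle_shift[OF assms] cocycle_fst[OF assms, of w] act_simps)

lemma cocycle_zero: "(\<lambda>_. 0, \<lambda>_ _. 0) \<in> cocycles R W V"
  by (simp add: cocycle_iff shift_linear)

lemma cocycle_add:
  assumes "y \<in> cocycles R W V" and "z \<in> cocycles R W V"
  shows "(\<lambda>w. fst y w + fst z w, \<lambda>a w. snd y a w + snd z a w) \<in> cocycles R W V"
  using assms by (auto simp: cocycle_iff at_lam_add shift_linear act_simps scale_right_distrib)

lemma cocycle_scale:
  assumes "z \<in> cocycles R W V"
  shows "cochain_scale V k z \<in> cocycles R W V"
proof -
  have "scl V w (scl V k (fst z 1)) = scl V k (fst z w)" for w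
    by (simp only: cocycle_fst[OF assms, of w] scale_left_commute)
  then show ?thesis
    by (simp add: cocycle_iff cochain_scale_def at_lam_pscl shift_linear act_simps cocycle_shift[OF assms])
qed

lemma dmodule_ext_of_cocycle: "z \<in> cocycles R W V \<Longrightarrow> dmodule (ext_of V W z)"
  by (auto simp: cocycles_def dest: conformal_moduleD(2))

lemma extension_ext_of:
  assumes "z \<in> cocycles R W V"
  shows "extension R V W (ext_of V W z) ext_in snd"
proof -
  let ?E = "ext_of V W z"
  have E: "conformal_module R ?E" using assms by (simp add: cocycles_def)
  note dE = conformal_moduleD(2)[OF E]
  interpret E: deriv_module ?E by unfold_locales (rule dE)
  have z0: "fst z 0 = 0" using cocycle_fst[OF assms, of 0] by simp
  have s0: "snd z a 0 = 0" for a
    by (rule cocycle_snd_eqI[OF assms]) (simp add: z0 shift_linear)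
  have "conformal_hom V ?E ext_in"
    by (rule conformal_homI[OF dmodule dE])
      (use linear_inl[of z] in \<open>simp_all add: ext_in_def[abs_def] ext_of_simps(2) z0 s0 act_at_ext_of[OF dE]\<close>)
  moreover have "conformal_hom ?E W snd"
    by (rule conformal_homI[OF dE dmodule_one_dim_mod])
      (use dmodule_one_dim_mod[of \<eta>] in \<open>auto simp: dmodule_def Vector_Spaces.linear_iff ext_of_simps(1,2)
        act_at_ext_of[OF dE] E.vector_space_axioms\<close>)
  ultimately show ?thesis
    unfolding extension_def
    using E conformal conformal_module_one_dim_mod[OF conformal_moduleD(1)[OF conformal]]
    by (auto simp: inj_on_def ext_in_def intro: surjI[of snd "\<lambda>w. (0, w)"])
qed

end


section \<open>Extensions up to equivalence\<close>

locale one_dim_extension = torsion_free_module R V \<eta>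
  for R :: "'r::ab_group_add lca" and V :: "('r, 'v::ab_group_add) cmod" and \<eta> :: complex +
  fixes E :: "('r, 'e::ab_group_add) cmod" and \<iota> :: "'v \<Rightarrow> 'e" and \<pi> :: "'e \<Rightarrow> complex"
  assumes extension: "extension R V (one_dim_mod \<eta>) E \<iota> \<pi>"
begin

lemma conformal_E: "conformal_module R E"
  using extension by (simp add: extension_def)

sublocale E: deriv_module E
  by unfold_locales (rule conformal_moduleD(2)[OF conformal_E])

lemma inj: "\<iota> x = \<iota> y \<longleftrightarrow> x = y"
  using extension by (auto simp: extension_def inj_on_def)

lemma hom_\<iota>: "conformal_hom V E \<iota>" and hom_\<pi>: "conformal_hom E W \<pi>"
  using extension by (simp_all add: extension_def)

lemma \<iota>_simps:
  "\<iota> (x + y) = \<iota> x + \<iota> y" "\<iota> (scl V k x) = scl E k (\<iota> x)" "\<iota> 0 = 0" "\<iota> (x - y) = \<iota> x - \<iota> y"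
  "\<iota> (der V x) = der E (\<iota> x)" "\<iota> (act_at V a l x) = act_at E a l (\<iota> x)"
  using conformal_homD[OF hom_\<iota>] dmodule E.dmodule by simp_all

lemma \<pi>_simps:
  "\<pi> (x + y) = \<pi> x + \<pi> y" "\<pi> (scl E k x) = k * \<pi> x" "\<pi> 0 = 0" "\<pi> (x - y) = \<pi> x - \<pi> y"
  "\<pi> (der E x) = \<eta> * \<pi> x" "\<pi> (act_at E a l x) = 0"
  using conformal_homD[OF hom_\<pi>] dmodule_one_dim_mod[of \<eta>] E.dmodule by simp_all

lemma exact: "\<pi> e = 0 \<longleftrightarrow> (\<exists>x. e = \<iota> x)"
  using extension by (auto simp: extension_def)

lemma \<pi>_\<iota> [simp]: "\<pi> (\<iota> x) = 0"
  using exact by blast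

lemma ex_lift: "\<exists>c. \<pi> c = 1"
  using extension by (metis extension_def surj_def)

text \<open>A lift \<open>c\<close> of the generator splits the extension as a vector space: \<open>E = \<iota>(V) \<oplus> \<complex>c\<close>.\<close>

lemma decompose:
  assumes "\<pi> c = 1"
  obtains x where "e = \<iota> x + scl E (\<pi> e) c"
proof -
  have "\<pi> (e - scl E (\<pi> e) c) = 0" using assms by (simp add: \<pi>_simps)
  then show ?thesis using that by (auto simp: exact algebra_simps)
qed

lemma linear_\<iota>: "Vector_Spaces.linear (scl V) (scl E) \<iota>"
  using hom_\<iota> by (simp add: conformal_hom_def)

lemma poly_in_kernel:
  assumes "map_poly \<pi> p = 0"
  obtains q where "p = map_poly \<iota> q"
proof
  have "\<pi> (coeff p i) = 0" for i
    using assms coeff_map_poly[of \<pi> p i] by (simp add: \<pi>_simps)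
  then have "\<iota> (inv_into UNIV \<iota> (coeff p i)) = coeff p i" for i
    by (metis exact f_inv_into_f rangeI)
  moreover have "inv_into UNIV \<iota> 0 = 0"
    by (metis \<iota>_simps(3) inj inj_def inv_f_f)
  ultimately show "p = map_poly \<iota> (map_poly (inv_into UNIV \<iota>) p)"
    by (intro poly_eqI) (simp add: coeff_map_poly \<iota>_simps)
qed

text \<open>The cocycle of the splitting given by \<open>c\<close>: here \<open>\<theta>(1)\<close> is \<open>(\<partial> - \<eta>)c\<close> and \<open>\<psi>(a, 1)\<close> is \<open>a\<^sub>\<lambda> c\<close>, both of
which lie in the kernel of \<open>\<pi>\<close>.  The quotient property of \<open>\<psi>\<close> is the identity
\<open>a\<^sub>\<lambda> ((\<partial> - \<eta>)c) = (\<partial> + \<lambda> - \<eta>) (a\<^sub>\<lambda> c)\<close>.\<close>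

lemma extension_cocycle:
  assumes "\<pi> c = 1"
  shows "\<exists>z \<in> cocycles R W V. der E c = scl E \<eta> c + \<iota> (fst z 1) \<and>
    (\<forall>a. act E a c = map_poly \<iota> (snd z a 1))"
proof -
  obtain h where h: "der E c = scl E \<eta> c + \<iota> h"
    using decompose[OF assms, of "der E c"] assms by (metis \<pi>_simps(5) add.commute mult.right_neutral)
  have "\<exists>q. act E a c = map_poly \<iota> q \<and> (\<forall>l. shift l (at_lam V q l) = act_at V a l h)" for a
  proof -
    have "map_poly \<pi> (act E a c) = 0"
      using hom_\<pi> by (simp add: conformal_hom_def)
    then obtain q where q: "act E a c = map_poly \<iota> q" by (rule poly_in_kernel)
    have at_q: "\<iota> (at_lam V q l) = act_at E a l c" for l
      by (simp add: q at_lam_map_poly[OF linear_\<iota> dmodule E.dmodule])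
    have "\<iota> (shift l (at_lam V q l)) = \<iota> (act_at V a l h)" for l
    proof -
      have "\<iota> (shift l (at_lam V q l)) = der E (act_at E a l c) + scl E (l - \<eta>) (act_at E a l c)"
        by (simp add: shift_def \<iota>_simps at_q)
      also have "\<dots> = act_at E a l (der E c) - scl E \<eta> (act_at E a l c)"
        by (simp add: conformal_moduleD(8)[OF conformal_E] E.scale_left_diff_distrib)
      also have "\<dots> = \<iota> (act_at V a l h)"
        by (simp add: h conformal_moduleD(5,6)[OF conformal_E] \<iota>_simps)
      finally show ?thesis .
    qed
    then show ?thesis using q by (auto simp: inj)
  qed
  then obtain q where q: "\<And>a. act E a c = map_poly \<iota> (q a)"
      "\<And>a l. shift l (at_lam V (q a) l) = act_at V a l h"
    by metis
  obtain z where z: "z \<in> cocycles R W V" "fst z 1 = h"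
    using cocycle_exists[of h] q(2) by blast
  have "snd z a 1 = q a" for a
    by (rule cocycle_snd_eqI[OF z(1)]) (simp add: q(2) z(2))
  with z q(1) h show ?thesis by (intro bexI[of _ z]) simp_all
qed

text \<open>The extension of a cocycle has the lift \<open>(0, 1)\<close> with \<open>(\<partial> - \<eta>)(0, 1) = (\<theta>(1), 0)\<close>, so an equivalent
extension must have a lift with the same value of \<open>\<partial> - \<eta>\<close>.  This is sufficient as well, since the
action on a lift is determined by that value.\<close>

lemma ext_equivalent_iff:
  assumes z: "z \<in> cocycles R W V"
  shows "ext_equivalent E \<iota> \<pi> (ext_of V W z) ext_in snd \<longleftrightarrow>
    (\<exists>c. \<pi> c = 1 \<and> der E c = scl E \<eta> c + \<iota> (fst z 1))"
proof
  let ?Z = "ext_of V W z"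
  note dZ = dmodule_ext_of_cocycle[OF z]
  assume "ext_equivalent E \<iota> \<pi> ?Z ext_in snd"
  then obtain \<phi> where \<phi>: "conformal_hom E ?Z \<phi>"
    and \<phi>_\<iota>: "\<phi> (\<iota> x) = (x, 0)" and \<phi>_\<pi>: "snd (\<phi> e) = \<pi> e" for x e
    by (auto simp: ext_equivalent_def fun_eq_iff ext_in_def)
  note \<phi>_simps = conformal_homD(1-5)[OF \<phi>]
  obtain c0 where c0: "\<pi> c0 = 1" using ex_lift by blast
  obtain x where x: "\<phi> c0 = (x, 1)"
    using \<phi>_\<pi>[of c0] c0 by (metis prod.collapse)
  \<comment> \<open>the preimage of \<open>(0, 1)\<close>\<close>
  define c where "c = c0 - \<iota> x"
  have c: "\<pi> c = 1" "\<phi> c = (0, 1)"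
    using c0 by (simp_all add: c_def \<pi>_simps \<phi>_simps x \<phi>_\<iota>)
  obtain y where y: "der E c = scl E \<eta> c + \<iota> y"
    using extension_cocycle[OF c(1)] by metis
  have "\<phi> (der E c) = (fst z 1, \<eta>)"
    by (simp add: \<phi>_simps c ext_of_simps)
  moreover have "\<phi> (der E c) = (y, \<eta>)"
    by (simp add: y \<phi>_simps c ext_of_simps \<phi>_\<iota>)
  ultimately have "y = fst z 1" by simp
  with c y show "\<exists>c. \<pi> c = 1 \<and> der E c = scl E \<eta> c + \<iota> (fst z 1)" by blast
next
  let ?Z = "ext_of V W z"
  note dZ = dmodule_ext_of_cocycle[OF z]
  interpret Z: deriv_module ?Z by unfold_locales (rule dZ)
  assume "\<exists>c. \<pi> c = 1 \<and> der E c = scl E \<eta> c + \<iota> (fst z 1)"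
  then obtain c where c: "\<pi> c = 1" and der_c: "der E c = scl E \<eta> c + \<iota> (fst z 1)" by blast
  have act_c: "act E a c = map_poly \<iota> (snd z a 1)" for a
    using extension_cocycle[OF c] z der_c cocycle_eqI by (metis add_left_cancel inj)
  have act_at_c: "act_at E a l c = \<iota> (at_lam V (snd z a 1) l)" for a l
    by (simp add: act_c at_lam_map_poly[OF linear_\<iota> dmodule E.dmodule])
  \<comment> \<open>the map \<open>\<iota>(x) + k c \<mapsto> (x, k)\<close>\<close>
  define \<phi> where "\<phi> e = (inv_into UNIV \<iota> (e - scl E (\<pi> e) c), \<pi> e)" for e
  have \<phi>_eq: "\<phi> (\<iota> x + scl E k c) = (x, k)" for x k
    using inj by (simp add: \<phi>_def \<pi>_simps c inj_def inv_f_f)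
  have rep: "\<exists>x k. e = \<iota> x + scl E k c" for e
    using decompose[OF c, of e] by blast
  have \<phi>_\<iota>: "\<phi> (\<iota> x) = (x, 0)" for x using \<phi>_eq[of x 0] by simp
  have add: "\<phi> (e + e') = \<phi> e + \<phi> e'" for e e'
  proof -
    obtain x k x' k' where e: "e = \<iota> x + scl E k c" "e' = \<iota> x' + scl E k' c" using rep by metis
    have "e + e' = \<iota> (x + x') + scl E (k + k') c"
      by (simp add: e \<iota>_simps E.scale_left_distrib add_ac)
    then show ?thesis by (simp add: \<phi>_eq e(1,2))
  qed
  have scale: "\<phi> (scl E m e) = scl ?Z m (\<phi> e)" for m e
  proof -
    obtain x k where e: "e = \<iota> x + scl E k c" using rep by metis
    have "scl E m e = \<iota> (scl V m x) + scl E (m * k) c"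
      by (simp add: e \<iota>_simps E.scale_right_distrib)
    then show ?thesis by (simp add: \<phi>_eq e ext_of_simps)
  qed
  have "\<phi> (der E e) = der ?Z (\<phi> e)" for e
  proof -
    obtain x k where e: "e = \<iota> x + scl E k c" using rep by metis
    have "der E e = \<iota> (der V x + fst z k) + scl E (\<eta> * k) c"
      by (simp add: e \<iota>_simps E.der_add E.der_scl der_c cocycle_fst[OF z, of k]
          E.scale_right_distrib add_ac mult.commute)
    then show ?thesis by (simp add: \<phi>_eq e ext_of_simps)
  qed
  moreover have "\<phi> (act_at E a l e) = act_at ?Z a l (\<phi> e)" for a l e
  proof -
    obtain x k where e: "e = \<iota> x + scl E k c" using rep by metis
    have "act_at E a l e = \<iota> (act_at V a l x + at_lam V (snd z a k) l)"
      by (simp add: e \<iota>_simps conformal_moduleD(5,6)[OF conformal_E] act_at_c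
          cocycle_snd_scale[OF z, of a k] at_lam_pscl)
    then show ?thesis by (simp add: \<phi>_\<iota> \<phi>_eq e act_at_ext_of[OF dZ])
  qed
  ultimately have "conformal_hom E ?Z \<phi>"
    using add scale
    by (intro conformal_homI E.dmodule dZ)
      (simp_all add: Vector_Spaces.linear_iff E.vector_space_axioms Z.vector_space_axioms)
  moreover have "\<phi> \<circ> \<iota> = ext_in"
    by (simp add: fun_eq_iff ext_in_def \<phi>_\<iota>)
  moreover have "snd \<circ> \<phi> = \<pi>"
    by (simp add: fun_eq_iff \<phi>_def)
  ultimately show "ext_equivalent E \<iota> \<pi> ?Z ext_in snd"
    unfolding ext_equivalent_def by blast
qed

end

section \<open>The free module of rank one\<close>

context deriv_module begin

lemma dact_0 [simp]: "dact M 0 x = 0"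
  by (simp add: dact_def)

lemma dact_bound:
  assumes "degree p \<le> n"
  shows "dact M p x = (\<Sum>i\<le>n. scl M (coeff p i) ((der M ^^ i) x))"
  unfolding dact_def
  by (rule sum.mono_neutral_left) (use assms in \<open>auto simp: coeff_eq_0\<close>)

lemma dact_pCons: "dact M (pCons a p) x = scl M a x + der M (dact M p x)"
proof -
  have der_sum: "der M (sum f S) = (\<Sum>i\<in>S. der M (f i))" for f :: "nat \<Rightarrow> 'v" and S
    by (induction S rule: infinite_finite_induct) (simp_all add: der_add)
  have "dact M (pCons a p) x = (\<Sum>i\<le>Suc (degree p). scl M (coeff (pCons a p) i) ((der M ^^ i) x))"
    by (rule dact_bound) (simp add: degree_pCons_le)
  also have "\<dots> = scl M a x + der M (dact M p x)"
    by (simp add: sum.atMost_Suc_shift dact_def der_sum der_scl del: sum.atMost_Suc)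
  finally show ?thesis .
qed

lemma dact_1 [simp]: "dact M 1 x = x"
  by (simp add: dact_def)

lemma dact_add: "dact M (p + q) x = dact M p x + dact M q x"
  by (induction p q rule: poly_induct2)
    (simp_all add: dact_pCons der_add scale_left_distrib add_ac)

lemma dact_smult: "dact M (Polynomial.smult c p) x = scl M c (dact M p x)"
  by (induction p) (simp_all add: dact_pCons der_scl scale_right_distrib)

lemma dlact_pCons: "dlact M (pCons p f) x = pCons (dact M p x) (dlact M f x)"
  by (simp add: dlact_def map_poly_pCons)

lemma dlact_0 [simp]: "dlact M 0 x = 0"
  by (simp add: dlact_def)

end

locale free_rank_one = deriv_module V
  for V :: "('v::ab_group_add, 'm) dmod_scheme" +
  fixes v :: 'v
  assumes free: "\<exists>!p. x = dact V p v"
begin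

definition coord :: "'v \<Rightarrow> complex poly" where
  "coord x = (THE p. x = dact V p v)"

lemma dact_coord [simp]: "dact V (coord x) v = x"
  using theI'[OF free[of x]] by (simp add: coord_def)

lemma coord_eqI: "x = dact V p v \<Longrightarrow> coord x = p"
  using free[of x] dact_coord[of x] by metis

lemma coord_dact [simp]: "coord (dact V p v) = p"
  by (rule coord_eqI) simp

lemma coord_add: "coord (x + y) = coord x + coord y"
  by (rule coord_eqI) (simp add: dact_add)

lemma coord_scl: "coord (scl V c x) = Polynomial.smult c (coord x)"
  by (rule coord_eqI) (simp add: dact_smult)

lemma coord_der: "coord (der V x) = pCons 0 (coord x)"
  by (rule coord_eqI) (simp add: dact_pCons)

lemma coord_0 [simp]: "coord 0 = 0"
  by (rule coord_eqI) simp

lemma coord_generator [simp]: "coord v = 1"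
  by (rule coord_eqI) simp

lemma free_torsion_free:
  assumes "der V x = scl V c x"
  shows "x = 0"
proof -
  have "[:- c, 1:] * coord x = 0"
    using arg_cong[OF assms, of coord] by (simp add: coord_der coord_scl)
  then have "coord x = 0"
    by (simp only: mult_eq_0_iff) simp
  then show ?thesis using dact_coord[of x] by simp
qed

text \<open>The evaluation \<open>p(\<partial>)v \<mapsto> p(c)\<close> identifies the quotient of \<open>V\<close> by \<open>(\<partial> - c)V\<close> with \<open>\<complex>\<close>.\<close>

definition ev :: "complex \<Rightarrow> 'v \<Rightarrow> complex" where
  "ev c x = poly (coord x) c"

lemma ev_simps [simp]:
  "ev c (x + y) = ev c x + ev c y" "ev c (scl V k x) = k * ev c x" "ev c (der V x) = c * ev c x"
  "ev c 0 = 0" "ev c v = 1"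
  by (simp_all add: ev_def coord_add coord_scl coord_der)

lemma ev_diff [simp]: "ev c (x - y) = ev c x - ev c y"
  using ev_simps(1)[of c "x - y" y] by simp

lemma ev_eq_0_iff: "ev c x = 0 \<longleftrightarrow> (\<exists>k. x = der V k - scl V c k)"
proof
  assume "ev c x = 0"
  then obtain q where "coord x = [:- c, 1:] * q"
    by (auto simp: ev_def poly_eq_0_iff_dvd dvd_def)
  then have "x = dact V ([:- c, 1:] * q) v"
    by (metis dact_coord)
  also have "[:- c, 1:] * q = Polynomial.smult (- c) q + pCons 0 q"
    by simp
  also have "dact V \<dots> v = der V (dact V q v) - scl V c (dact V q v)"
    by (simp only: dact_add dact_smult dact_pCons) simp
  finally show "\<exists>k. x = der V k - scl V c k" by blast
qed auto

lemma dlact_surj: "\<exists>f. q = dlact V f v"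
proof
  show "q = dlact V (map_poly coord q) v"
    by (induction q) (simp_all add: map_poly_pCons dlact_pCons)
qed

end

locale rank_one = free_rank_one V v
  for R :: "'r::ab_group_add lca" and V :: "('r, 'v::ab_group_add) cmod" and v :: 'v
    and \<eta> :: complex +
  assumes conformal_V: "conformal_module R V"
begin

sublocale torsion_free_module R V \<eta>
  by unfold_locales (fact conformal_V, fact free_torsion_free)

text \<open>Moving \<open>a\<^sub>l\<close> past \<open>p(\<partial>)\<close> turns it into \<open>p(\<partial> + l)\<close>.\<close>

lemma ev_act: "ev c (act_at V a l x) = ev (c + l) x * ev c (act_at V a l v)"
proof -
  have "ev c (act_at V a l (dact V p v)) = poly p (c + l) * ev c (act_at V a l v)" for p
    by (induction p) (simp_all add: dact_pCons act_simps algebra_simps)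
  from this[of "coord x"] show ?thesis by (simp add: ev_def)
qed

lemma ev_shift: "ev (\<eta> - l) (shift l x) = 0"
  by (simp add: shift_def algebra_simps)

text \<open>A necessary condition for \<open>\<theta>(1) = p(\<partial>)v\<close> to come from a cocycle: \<open>a\<^sub>l p(\<partial>)v\<close> lies in the image of
\<open>\<partial> - (\<eta> - l)\<close>, so evaluation at \<open>\<eta> - l\<close> kills it; but that evaluation is \<open>p(\<eta>)\<close> times the one of
\<open>a\<^sub>l v\<close>.\<close>

lemma cocycle_obstruction:
  assumes "z \<in> cocycles R W V" and "ev \<eta> (fst z 1) \<noteq> 0"
  shows "ev (\<eta> - l) (act_at V a l v) = 0"
  using ev_shift[of l "at_lam V (snd z a 1) l"] ev_act[of "\<eta> - l" a "fst z 1" l] assms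
  by (simp add: cocycle_shift)

text \<open>Replacing a lift \<open>c\<close> by \<open>c + \<iota>(k)\<close> changes \<open>(\<partial> - \<eta>)c\<close> by \<open>(\<partial> - \<eta>)k\<close>, so that only its class modulo
\<open>(\<partial> - \<eta>)V\<close>, that is its value under \<open>ev \<eta>\<close>, is an invariant of the extension.\<close>

lemma ext_equivalent_iff_ev:
  assumes ext: "extension R V W E \<iota> \<pi>" and y: "y \<in> cocycles R W V" and z: "z \<in> cocycles R W V"
    and c: "\<pi> c = 1" "der E c = scl E \<eta> c + \<iota> (fst y 1)"
  shows "ext_equivalent E \<iota> \<pi> (ext_of V W z) ext_in snd \<longleftrightarrow> ev \<eta> (fst z 1) = ev \<eta> (fst y 1)"
proof -
  interpret one_dim_extension R V \<eta> E \<iota> \<pi> by unfold_locales fact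
  have "(\<exists>c. \<pi> c = 1 \<and> der E c = scl E \<eta> c + \<iota> (fst z 1)) \<longleftrightarrow>
      (\<exists>k. fst z 1 - fst y 1 = der V k - scl V \<eta> k)"
  proof
    assume "\<exists>c. \<pi> c = 1 \<and> der E c = scl E \<eta> c + \<iota> (fst z 1)"
    then obtain c' where c': "\<pi> c' = 1" "der E c' = scl E \<eta> c' + \<iota> (fst z 1)" by blast
    have "\<pi> (c' - c) = 0" using c c' by (simp add: \<pi>_simps)
    then obtain k where k: "c' - c = \<iota> k" by (auto simp: exact)
    have "\<iota> (fst z 1 - fst y 1) = \<iota> (der V k - scl V \<eta> k)"
      by (simp add: \<iota>_simps c' c E.der_diff E.scale_right_diff_distrib flip: k)
    then show "\<exists>k. fst z 1 - fst y 1 = der V k - scl V \<eta> k"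
      by (auto simp: inj)
  next
    assume "\<exists>k. fst z 1 - fst y 1 = der V k - scl V \<eta> k"
    then obtain k where k: "fst z 1 = fst y 1 + der V k - scl V \<eta> k"
      by (auto simp: algebra_simps)
    have "\<pi> (c + \<iota> k) = 1 \<and> der E (c + \<iota> k) = scl E \<eta> (c + \<iota> k) + \<iota> (fst z 1)"
      by (simp add: \<pi>_simps \<iota>_simps c k E.der_add E.scale_right_distrib)
    then show "\<exists>c. \<pi> c = 1 \<and> der E c = scl E \<eta> c + \<iota> (fst z 1)" by blast
  qed
  then show ?thesis
    using ev_eq_0_iff[of \<eta> "fst z 1 - fst y 1"] by (simp add: ext_equivalent_iff[OF z])
qed

lemma trivial_extension_iff_ev:
  assumes "extension R V W E \<iota> \<pi>" and "y \<in> cocycles R W V"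
    and "\<pi> c = 1" "der E c = scl E \<eta> c + \<iota> (fst y 1)"
  shows "trivial_extension V W E \<iota> \<pi> \<longleftrightarrow> ev \<eta> (fst y 1) = 0"
  using ext_equivalent_iff_ev[OF assms(1,2) cocycle_zero assms(3,4)]
  by (auto simp: trivial_extension_def direct_sum_mod_eq_ext_of)

lemma ext_of_lift:
  "der (ext_of V W z) (0, 1) = scl (ext_of V W z) \<eta> (0, 1) + ext_in (fst z 1)"
  by (simp add: ext_of_simps ext_in_def)

lemma ext_of_equivalent_iff_ev:
  assumes "y \<in> cocycles R W V" and "z \<in> cocycles R W V"
  shows "ext_equivalent (ext_of V W y) ext_in snd (ext_of V W z) ext_in snd \<longleftrightarrow>
    ev \<eta> (fst z 1) = ev \<eta> (fst y 1)"
  by (rule ext_equivalent_iff_ev[OF extension_ext_of[OF assms(1)] assms _ ext_of_lift]) simp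

lemma trivial_cocycles_eq: "trivial_cocycles R W V = {z \<in> cocycles R W V. ev \<eta> (fst z 1) = 0}"
  using trivial_extension_iff_ev[OF extension_ext_of _ _ ext_of_lift]
  by (auto simp: trivial_cocycles_def)

end

section \<open>The space of extensions\<close>

text \<open>Transport of structure from the field along \<open>C\<close>; in the application \<open>C k\<close> is a coset of cocycles.\<close>

lemma one_dim_vectorspace:
  fixes C :: "'k::field \<Rightarrow> 'b" and M :: "('k, 'b) module"
  assumes carrier: "carrier M = range C" and inj: "inj C"
    and add: "\<And>j k. C j \<oplus>\<^bsub>M\<^esub> C k = C (j + k)"
    and zero: "\<zero>\<^bsub>M\<^esub> = C 0"
    and smult: "\<And>j k. j \<odot>\<^bsub>M\<^esub> C k = C (j * k)"
  shows "vectorspace class_ring M" and "vectorspace.fin_dim class_ring M"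
    and "vectorspace.dim class_ring M = 1"
proof -
  show vs: "vectorspace class_ring M"
  proof (rule vs_criteria[OF class_field])
    have "C k \<oplus>\<^bsub>M\<^esub> C (- k) = \<zero>\<^bsub>M\<^esub>" for k by (simp add: add zero)
    then show "\<forall>v\<in>carrier M. \<exists>neg_v\<in>carrier M. v \<oplus>\<^bsub>M\<^esub> neg_v = \<zero>\<^bsub>M\<^esub>"
      unfolding carrier by blast
  qed (auto simp: carrier add zero smult algebra_simps)
  interpret vectorspace class_ring M by (rule vs)
  have "C k \<in> span {C 1}" for k
  proof -
    have "C k = lincomb (\<lambda>_. k) {C 1}"
      by (simp add: lincomb_def smult carrier)
    then show ?thesis unfolding span_def by fastforce
  qed
  then have gen: "span {C 1} = carrier M"
    using span_is_subset2[of "{C 1}"] by (auto simp: carrier)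
  then show "fin_dim"
    unfolding fin_dim_def using carrier by (intro exI[of _ "{C 1}"]) auto
  have "span {} = {\<zero>\<^bsub>M\<^esub>}"
    by (auto simp: span_def lincomb_def)
  moreover have "C 1 \<noteq> C 0" using inj by (simp add: inj_eq)
  ultimately have "span {} \<noteq> carrier M"
    unfolding carrier zero by blast
  then show "dim = 1"
    unfolding dim_def
    by (intro Least_equality exI[of _ "{C 1}"])
      (auto simp: gen carrier Suc_le_eq card_gt_0_iff)
qed

context rank_one begin

text \<open>The trivial cocycles are the kernel of the linear functional \<open>(\<theta>, \<psi>) \<mapsto> ev \<eta> \<theta>(1)\<close>, so their cosets are
its level sets \<open>C k\<close>; multiples of one cocycle with nonzero value make every level set nonempty.\<close>

lemma Ext_one_dimensional:
  assumes u: "u \<in> cocycles R W V" and ev_u: "ev \<eta> (fst u 1) = 1"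
  shows "vectorspace class_ring (Ext R W V)" and "vectorspace.fin_dim class_ring (Ext R W V)"
    and "vectorspace.dim class_ring (Ext R W V) = 1"
proof -
  define C where "C k = {z \<in> cocycles R W V. ev \<eta> (fst z 1) = k}" for k
  define Z where "Z = cocycle_space R W V"
  define T where "T = trivial_cocycles R W V"
  have T: "T = C 0" by (simp add: T_def C_def trivial_cocycles_eq)
  have carrier_Z: "carrier Z = cocycles R W V" by (simp add: Z_def cocycle_space_def)
  have add_in: "y \<oplus>\<^bsub>Z\<^esub> z \<in> C (j + k)" if "y \<in> C j" "z \<in> C k" for y z j k
    using that cocycle_add[of y z] by (simp add: Z_def cocycle_space_def C_def)
  have fst_add: "fst (y \<oplus>\<^bsub>Z\<^esub> z) 1 = fst y 1 + fst z 1" for y z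
    by (simp add: Z_def cocycle_space_def)
  have fst_scale: "fst (cochain_scale V k z) 1 = scl V k (fst z 1)"
    for k and z :: "('r, complex, 'v) cochain"
    by (simp add: cochain_scale_def)
  have scale_in: "cochain_scale V k z \<in> C (k * j)" if "z \<in> C j" for k j z
    using that cocycle_scale[of z k] by (simp add: C_def fst_scale)
  have u_in: "cochain_scale V k u \<in> C k" for k
    using scale_in[of u 1 k] u ev_u by (simp add: C_def)
  have sum: "\<exists>z \<in> C k. y = x \<oplus>\<^bsub>Z\<^esub> z" if "y \<in> C (j + k)" "x \<in> C j" for x y j k
  proof
    let ?z = "y \<oplus>\<^bsub>Z\<^esub> cochain_scale V (- 1) x"
    show z: "?z \<in> C k"
      using add_in[OF that(1) scale_in[OF that(2), of "- 1"]] by simp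
    \<comment> \<open>Both sides are cocycles, so it suffices to compare their first components at \<open>1\<close>.\<close>
    show "y = x \<oplus>\<^bsub>Z\<^esub> ?z"
      by (rule cocycle_eqI)
        (use that add_in[OF that(2) z] in \<open>auto simp: C_def fst_add fst_scale\<close>)
  qed
  have comm: "x \<oplus>\<^bsub>Z\<^esub> z = z \<oplus>\<^bsub>Z\<^esub> x" for x z
    by (simp add: Z_def cocycle_space_def add.commute)
  have set_add: "C j <+>\<^bsub>Z\<^esub> C k = C (j + k)" for j k
  proof
    show "C j <+>\<^bsub>Z\<^esub> C k \<subseteq> C (j + k)"
      using add_in by (auto simp: set_add_def')
    show "C (j + k) \<subseteq> C j <+>\<^bsub>Z\<^esub> C k"
    proof
      fix y assume "y \<in> C (j + k)"
      from sum[OF this u_in] show "y \<in> C j <+>\<^bsub>Z\<^esub> C k"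
        using u_in[of j] by (auto simp: set_add_def')
    qed
  qed
  have coset: "T +>\<^bsub>Z\<^esub> z = C k" if z: "z \<in> C k" for z k
  proof
    show "T +>\<^bsub>Z\<^esub> z \<subseteq> C k"
      using add_in[of _ 0 z k] z by (auto simp: T a_r_coset_def')
    show "C k \<subseteq> T +>\<^bsub>Z\<^esub> z"
    proof
      fix y assume "y \<in> C k"
      then obtain x where "x \<in> C 0" "y = z \<oplus>\<^bsub>Z\<^esub> x" using sum[of y k 0 z] z by auto
      then show "y \<in> T +>\<^bsub>Z\<^esub> z" by (auto simp: T a_r_coset_def' comm[of z])
    qed
  qed
  have cosets: "a_rcosets\<^bsub>Z\<^esub> T = range C"
  proof
    show "a_rcosets\<^bsub>Z\<^esub> T \<subseteq> range C"
    proof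
      fix X assume "X \<in> a_rcosets\<^bsub>Z\<^esub> T"
      then obtain z where z: "z \<in> cocycles R W V" "X = T +>\<^bsub>Z\<^esub> z"
        by (auto simp: A_RCOSETS_def' carrier_Z)
      then show "X \<in> range C" using coset[of z "ev \<eta> (fst z 1)"] by (simp add: C_def)
    qed
    show "range C \<subseteq> a_rcosets\<^bsub>Z\<^esub> T"
      using coset[OF u_in] cocycle_scale[OF u] by (auto simp: A_RCOSETS_def' carrier_Z)
  qed
  have smult: "(\<Union>z\<in>C k. T +>\<^bsub>Z\<^esub> cochain_scale V m z) = C (m * k)" for m k
    using coset[OF scale_in] u_in[of k] by auto
  have "inj C"
    using u_in by (fastforce simp: inj_def C_def)
  note Ext_def' = Ext_def[of R W V, folded Z_def T_def, unfolded Let_def]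
  have "carrier (Ext R W V) = range C" "\<And>j k. C j \<oplus>\<^bsub>Ext R W V\<^esub> C k = C (j + k)"
    "\<zero>\<^bsub>Ext R W V\<^esub> = C 0" "\<And>j k. j \<odot>\<^bsub>Ext R W V\<^esub> C k = C (j * k)"
    by (simp_all add: Ext_def' cosets set_add smult) (rule T)
  from one_dim_vectorspace[OF this(1) \<open>inj C\<close> this(2-4)]
  show "vectorspace class_ring (Ext R W V)" and "vectorspace.fin_dim class_ring (Ext R W V)"
    and "vectorspace.dim class_ring (Ext R W V) = 1" by this
qed

end


section \<open>Modules over the algebra of Type I\<close>

context one_dim_extension begin

lemma \<iota>_dact: "\<iota> (dact V p x) = dact E p (\<iota> x)"
  by (induction p) (simp_all add: dact_pCons E.dact_pCons \<iota>_simps)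

lemma \<iota>_dlact: "map_poly \<iota> (dlact V f x) = dlact E f (\<iota> x)"
  by (induction f) (simp_all add: dlact_pCons E.dlact_pCons map_poly_pCons \<iota>_simps \<iota>_dact)

lemma rank_one_relations_\<iota>:
  assumes "rank_one_relations V A B v \<delta>1 \<delta>2 \<alpha> \<beta> \<phi>"
  shows "rank_one_relations E A B (\<iota> v) \<delta>1 \<delta>2 \<alpha> \<beta> \<phi>"
proof -
  have "act E a (\<iota> v) = map_poly \<iota> (act V a v)" for a
    using hom_\<iota> by (simp add: conformal_hom_def)
  with assms show ?thesis by (simp add: rank_one_relations_def \<iota>_dlact)
qed

end

locale type_I_module = rank_one R V v \<eta>
  for R :: "'r::ab_group_add lca" and V :: "('r, 'v::ab_group_add) cmod" and v :: 'v
    and \<eta> :: complex +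
  fixes A B :: 'r and \<delta>1 \<delta>2 \<alpha> \<beta> :: complex and \<phi> :: "complex poly"
  assumes type_I: "type_I R A B"
    and relations: "rank_one_relations V A B v \<delta>1 \<delta>2 \<alpha> \<beta> \<phi>"
begin

lemma act_A: "act V A v = [:scl V (\<delta>1 * \<beta>) v + scl V \<delta>1 (der V v), scl V (\<delta>1 * \<alpha>) v:]"
  using relations by (simp add: rank_one_relations_def dlact_pCons dact_pCons der_scl)

lemma act_at_B: "act_at V B l v = scl V (\<delta>2 * poly \<phi> l) v"
proof -
  have "at_lam V (dlact V (map_poly (\<lambda>c. [:\<delta>2 * c:]) p) v) l = scl V (\<delta>2 * poly p l) v" for p
    by (induction p) (simp_all add: map_poly_pCons dlact_pCons dact_pCons at_lam_pCons
        algebra_simps)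
  with relations show ?thesis by (simp add: rank_one_relations_def)
qed

text \<open>The obstruction at the generators is \<open>\<delta>\<^sub>1(\<beta> + \<eta> + (\<alpha> - 1)l) = 0\<close> and \<open>\<delta>\<^sub>2 \<phi>(l) = 0\<close> for all \<open>l\<close>.\<close>

lemma nonvanishing_class:
  assumes "z \<in> cocycles R W V" and "ev \<eta> (fst z 1) \<noteq> 0"
    and "\<delta>1\<^sup>2 + \<delta>2\<^sup>2 = 1" and "\<phi> \<noteq> 0" and "\<delta>1 \<in> {0, 1}"
  shows "\<delta>1 = 1 \<and> \<alpha> = 1 \<and> \<beta> + \<eta> = 0"
proof -
  have A: "\<delta>1 * (\<beta> + (\<eta> - l) + \<alpha> * l) = 0" for l
    using cocycle_obstruction[OF assms(1,2), of l A]
    by (simp add: act_A at_lam_pCons algebra_simps)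
  have B: "\<delta>2 * poly \<phi> l = 0" for l
    using cocycle_obstruction[OF assms(1,2), of l B] by (simp add: act_at_B)
  have "\<delta>2 = 0"
    using B \<open>\<phi> \<noteq> 0\<close> by (metis mult_eq_0_iff poly_all_0_iff_0)
  with assms have "\<delta>1 = 1" by auto
  with A[of 0] A[of 1] show ?thesis by (auto simp: algebra_simps)
qed

text \<open>For \<open>\<alpha> = 1\<close> and \<open>\<beta> = -\<eta>\<close> the action \<open>A\<^sub>\<lambda> v = (\<partial> + \<lambda> - \<eta>)v\<close> is itself divisible by \<open>\<partial> + \<lambda> - \<eta>\<close>, with
quotient \<open>v\<close>.  The elements \<open>a\<close> of the algebra for which \<open>a\<^sub>\<lambda> v\<close> is divisible form a
\<open>\<complex>[\<partial>]\<close>-submodule, so it is enough to divide for \<open>A\<close> and \<open>B\<close>.\<close>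

lemma ex_generating_cocycle:
  assumes "\<delta>1 = 1" "\<alpha> = 1" "\<beta> + \<eta> = 0" "\<delta>2 = 0"
  obtains u where "u \<in> cocycles R W V" and "fst u 1 = v"
proof -
  define P where "P a \<longleftrightarrow> (\<exists>q. \<forall>l. shift l (at_lam V q l) = act_at V a l v)" for a
  interpret R: deriv_module R
    by unfold_locales (use type_I in \<open>simp add: type_I_def lie_conformal_algebra_def\<close>)
  have add: "P (a + b)" if Pab: "P a" "P b" for a b
  proof -
    obtain p q where "\<forall>l. shift l (at_lam V p l) = act_at V a l v"
      "\<forall>l. shift l (at_lam V q l) = act_at V b l v" using Pab unfolding P_def by blast
    then show ?thesis
      by (auto simp: P_def at_lam_add shift_linear act_simps intro!: exI[of _ "p + q"])
  qed
  have scale: "P (scl R k a)" if Pa: "P a" for a k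
  proof -
    obtain p where "\<forall>l. shift l (at_lam V p l) = act_at V a l v" using Pa unfolding P_def by blast
    then show ?thesis
      by (auto simp: P_def at_lam_pscl shift_linear act_simps intro!: exI[of _ "pscl V k p"])
  qed
  have der: "P (der R a)" if Pa: "P a" for a
  proof -
    obtain p where "\<forall>l. shift l (at_lam V p l) = act_at V a l v" using Pa unfolding P_def by blast
    then show ?thesis
      by (auto simp: P_def at_lam_minus at_lam_pCons shift_linear act_simps
          intro!: exI[of _ "- pCons 0 p"])
  qed
  have dact: "P (dact R p a)" if "P a" for p a
  proof (induction p)
    case 0
    then show ?case using scale[OF that, of 0] by simp
  next
    case (pCons k p)
    then show ?case by (simp add: R.dact_pCons add scale that der)
  qed
  have "P A"
    unfolding P_def
    by (rule exI[of _ "[:v:]"])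
      (use assms in \<open>simp add: act_A at_lam_pCons shift_def eq_neg_iff_add_eq_0[symmetric] scale_left_diff_distrib\<close>)
  moreover have "P B"
    unfolding P_def by (rule exI[of _ 0]) (use assms in \<open>simp add: act_at_B shift_linear\<close>)
  ultimately have "P a" for a
    using type_I dact add unfolding type_I_def by metis
  then show ?thesis using cocycle_exists[of v] that by (auto simp: P_def)
qed

text \<open>The relations for \<open>A\<^sub>\<lambda> c\<^sub>\<eta>\<close> and \<open>B\<^sub>\<lambda> c\<^sub>\<eta>\<close> follow from the one for \<open>\<partial> c\<^sub>\<eta>\<close> by uniqueness of quotients.\<close>

lemma ext_relations_iff:
  assumes "\<delta>1 = 1" "\<alpha> = 1" "\<beta> + \<eta> = 0" "\<delta>2 = 0" and z: "z \<in> cocycles R W V"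
  shows "ext_relations (ext_of V W z) A B (v, 0) (0, 1) \<delta>1 \<delta>2 \<alpha> \<beta> \<phi> \<eta> [:[:s:]:] 0 [:s:] \<longleftrightarrow>
    fst z 1 = scl V s v"
proof
  interpret one_dim_extension R V \<eta> "ext_of V W z" ext_in snd
    by unfold_locales (rule extension_ext_of[OF z])
  show "fst z 1 = scl V s v"
    if "ext_relations (ext_of V W z) A B (v, 0) (0, 1) \<delta>1 \<delta>2 \<alpha> \<beta> \<phi> \<eta> [:[:s:]:] 0 [:s:]"
    using that by (simp add: ext_relations_def ext_of_simps E.dact_pCons)
  assume h: "fst z 1 = scl V s v"
  have \<beta>: "\<beta> = - \<eta>" using assms(3) by (simp add: eq_neg_iff_add_eq_0)
  have "snd z A 1 = [:scl V s v:]"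
    by (rule cocycle_snd_eqI[OF z])
      (simp add: h act_simps act_A assms(1,2) \<beta> at_lam_pCons shift_def der_scl algebra_simps)
  moreover have "snd z B 1 = 0"
    by (rule cocycle_snd_eqI[OF z]) (simp add: h act_simps act_at_B assms(4) shift_linear)
  moreover have "act V a 0 = 0" for a
    by (rule at_lam_eqI) simp
  ultimately show "ext_relations (ext_of V W z) A B (v, 0) (0, 1) \<delta>1 \<delta>2 \<alpha> \<beta> \<phi> \<eta> [:[:s:]:] 0 [:s:]"
    using rank_one_relations_\<iota>[OF relations]
    by (simp add: ext_relations_def ext_of_simps E.dact_pCons E.dlact_pCons h map_poly_pCons ext_in_def flip: zero_prod_def)
qed

lemma extension_normal_form:
  assumes "extension R V W E \<iota> \<pi>"
  shows "\<exists>c f g h. \<pi> c = 1 \<and>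
      (\<forall>e. \<exists>!pk. e = dact E (fst pk) (\<iota> v) + scl E (snd pk) c) \<and>
      ext_relations E A B (\<iota> v) c \<delta>1 \<delta>2 \<alpha> \<beta> \<phi> \<eta> f g h"
proof -
  interpret one_dim_extension R V \<eta> E \<iota> \<pi> by unfold_locales fact
  obtain c where c: "\<pi> c = 1" using ex_lift by blast
  obtain z where "z \<in> cocycles R W V" and z: "der E c = scl E \<eta> c + \<iota> (fst z 1)" "\<And>a. act E a c = map_poly \<iota> (snd z a 1)"
    using extension_cocycle[OF c] by metis
  obtain f g where fg: "snd z A 1 = dlact V f v" "snd z B 1 = dlact V g v"
    using dlact_surj by metis
  have "ext_relations E A B (\<iota> v) c \<delta>1 \<delta>2 \<alpha> \<beta> \<phi> \<eta> f g (coord (fst z 1))"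
    using rank_one_relations_\<iota>[OF relations]
    by (simp add: ext_relations_def z fg \<iota>_dlact flip: \<iota>_dact)
  moreover have "\<exists>!pk. e = dact E (fst pk) (\<iota> v) + scl E (snd pk) c" for e
  proof -
    obtain x where x: "e = \<iota> x + scl E (\<pi> e) c" by (rule decompose[OF c])
    show ?thesis
    proof (rule ex1I[of _ "(coord x, \<pi> e)"])
      show "e = dact E (fst (coord x, \<pi> e)) (\<iota> v) + scl E (snd (coord x, \<pi> e)) c"
        using x by (simp flip: \<iota>_dact)
    next
      fix pk assume pk: "e = dact E (fst pk) (\<iota> v) + scl E (snd pk) c"
      then have "\<pi> e = snd pk"
        by (simp add: \<pi>_simps c flip: \<iota>_dact)
      with pk x have "\<iota> x = \<iota> (dact V (fst pk) v)"
        by (metis \<iota>_dact add_right_cancel)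
      with \<open>\<pi> e = snd pk\<close> show "pk = (coord x, \<pi> e)"
        by (simp add: inj)
    qed
  qed
  ultimately show ?thesis using c by blast
qed

end

theorem theorem5p4:
  fixes R :: "'r::ab_group_add lca" and A B :: 'r
    and V :: "('r, 'v::ab_group_add) cmod" and v :: 'v
    and \<delta>1 \<delta>2 \<alpha> \<beta> \<eta> :: complex and \<phi> :: "complex poly"
  assumes "type_I R A B"
    and "\<delta>1 \<in> {0, 1}" and "\<delta>2 \<in> {0, 1}" and "\<delta>1\<^sup>2 + \<delta>2\<^sup>2 = 1" and "\<alpha> \<noteq> 0" and "\<phi> \<noteq> 0"
    and "rank_one_module R A B V v \<delta>1 \<delta>2 \<alpha> \<beta> \<phi>"
  shows
    "(\<forall>(E :: ('r, 'e::ab_group_add) cmod) \<iota> \<pi>.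
        extension R V (one_dim_mod \<eta>) E \<iota> \<pi> \<longrightarrow>
        (\<exists>c f g h. \<pi> c = 1 \<and>
          (\<forall>e. \<exists>!pk. e = dact E (fst pk) (\<iota> v) + scl E (snd pk) c) \<and>
          ext_relations E A B (\<iota> v) c \<delta>1 \<delta>2 \<alpha> \<beta> \<phi> \<eta> f g h))
     \<and> (\<forall>(E :: ('r, 'e) cmod) \<iota> \<pi>.
        extension R V (one_dim_mod \<eta>) E \<iota> \<pi> \<and>
        \<not> trivial_extension V (one_dim_mod \<eta>) E \<iota> \<pi> \<longrightarrow>
        \<delta>1 = 1 \<and> \<alpha> = 1 \<and> \<beta> + \<eta> = 0)
     \<and> (\<delta>1 = 1 \<and> \<alpha> = 1 \<and> \<beta> + \<eta> = 0 \<longrightarrow>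
        vectorspace class_ring (Ext R (one_dim_mod \<eta>) V) \<and>
        vectorspace.fin_dim class_ring (Ext R (one_dim_mod \<eta>) V) \<and>
        vectorspace.dim class_ring (Ext R (one_dim_mod \<eta>) V) = 1 \<and>
        \<delta>2 = 0 \<and>
        (\<forall>s. s \<noteq> 0 \<longrightarrow>
          (\<exists>!z. z \<in> cocycles R (one_dim_mod \<eta>) V \<and>
            ext_relations (ext_of V (one_dim_mod \<eta>) z) A B (v, 0) (0, 1)
              \<delta>1 \<delta>2 \<alpha> \<beta> \<phi> \<eta> [:[:s:]:] 0 [:s:]) \<and>
          (\<forall>z \<in> cocycles R (one_dim_mod \<eta>) V.
            ext_relations (ext_of V (one_dim_mod \<eta>) z) A B (v, 0) (0, 1)
              \<delta>1 \<delta>2 \<alpha> \<beta> \<phi> \<eta> [:[:s:]:] 0 [:s:] \<longrightarrow>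
            extension R V (one_dim_mod \<eta>) (ext_of V (one_dim_mod \<eta>) z) ext_in snd \<and>
            \<not> trivial_extension V (one_dim_mod \<eta>) (ext_of V (one_dim_mod \<eta>) z) ext_in snd)) \<and>
        (\<forall>(E :: ('r, 'e) cmod) \<iota> \<pi>.
          extension R V (one_dim_mod \<eta>) E \<iota> \<pi> \<and>
          \<not> trivial_extension V (one_dim_mod \<eta>) E \<iota> \<pi> \<longrightarrow>
          (\<exists>s. s \<noteq> 0 \<and> (\<exists>z \<in> cocycles R (one_dim_mod \<eta>) V.
            ext_relations (ext_of V (one_dim_mod \<eta>) z) A B (v, 0) (0, 1)
              \<delta>1 \<delta>2 \<alpha> \<beta> \<phi> \<eta> [:[:s:]:] 0 [:s:] \<and>
            ext_equivalent E \<iota> \<pi> (ext_of V (one_dim_mod \<eta>) z) ext_in snd))) \<and>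
        (\<forall>y \<in> cocycles R (one_dim_mod \<eta>) V - trivial_cocycles R (one_dim_mod \<eta>) V.
         \<forall>z \<in> cocycles R (one_dim_mod \<eta>) V - trivial_cocycles R (one_dim_mod \<eta>) V.
          \<exists>k. k \<noteq> 0 \<and>
            ext_equivalent (ext_of V (one_dim_mod \<eta>) z) ext_in snd
              (ext_of V (one_dim_mod \<eta>) (cochain_scale V k y)) ext_in snd))"
proof -
  have V: "conformal_module R V" and free: "\<And>x. \<exists>!p. x = dact V p v"
    and rel: "rank_one_relations V A B v \<delta>1 \<delta>2 \<alpha> \<beta> \<phi>"
    using assms(7) by (simp_all add: rank_one_module_def)
  interpret type_I_module R V v \<eta> A B \<delta>1 \<delta>2 \<alpha> \<beta> \<phi>
    by unfold_locales (fact conformal_moduleD(2)[OF V] free V assms(1) rel)+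
  have class_of: "\<exists>y c. y \<in> cocycles R W V \<and> \<pi> c = 1 \<and> der E c = scl E \<eta> c + \<iota> (fst y 1) \<and>
      (trivial_extension V W E \<iota> \<pi> \<longleftrightarrow> ev \<eta> (fst y 1) = 0)"
    if "extension R V W E \<iota> \<pi>" for E :: "('r, 'e) cmod" and \<iota> \<pi>
  proof -
    interpret one_dim_extension R V \<eta> E \<iota> \<pi> by unfold_locales fact
    obtain c where c: "\<pi> c = 1" using ex_lift by blast
    obtain y where "y \<in> cocycles R W V" "der E c = scl E \<eta> c + \<iota> (fst y 1)"
      using extension_cocycle[OF c] by metis
    with c trivial_extension_iff_ev[OF that] show ?thesis by blast
  qed
  have necessary: "\<delta>1 = 1 \<and> \<alpha> = 1 \<and> \<beta> + \<eta> = 0"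
    if "extension R V W E \<iota> \<pi>" "\<not> trivial_extension V W E \<iota> \<pi>"
    for E :: "('r, 'e) cmod" and \<iota> \<pi>
    using class_of[OF that(1)] that(2) nonvanishing_class assms(2,4,6) by metis
  show ?thesis
  proof (intro conjI impI)
    assume "\<delta>1 = 1 \<and> \<alpha> = 1 \<and> \<beta> + \<eta> = 0"
    then have \<delta>\<alpha>\<beta>: "\<delta>1 = 1" "\<alpha> = 1" "\<beta> + \<eta> = 0" by auto
    show "\<delta>2 = 0" using \<delta>\<alpha>\<beta>(1) assms(4) by simp
    note params = \<delta>\<alpha>\<beta> this
    note normal = ext_relations_iff[OF params]
    obtain u where u: "u \<in> cocycles R W V" "fst u 1 = v"
      by (rule ex_generating_cocycle[OF params])
    have su: "cochain_scale V s u \<in> cocycles R W V" "fst (cochain_scale V s u) 1 = scl V s v" for s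
      using cocycle_scale[OF u(1)] u(2) by (simp_all add: cochain_scale_def)
    show "vectorspace class_ring (Ext R W V)" "vectorspace.fin_dim class_ring (Ext R W V)"
      "vectorspace.dim class_ring (Ext R W V) = 1"
      using Ext_one_dimensional[OF u(1)] u(2) by simp_all
    show "\<forall>s. s \<noteq> 0 \<longrightarrow>
        (\<exists>!z. z \<in> cocycles R W V \<and>
          ext_relations (ext_of V W z) A B (v, 0) (0, 1) \<delta>1 \<delta>2 \<alpha> \<beta> \<phi> \<eta> [:[:s:]:] 0 [:s:]) \<and>
        (\<forall>z \<in> cocycles R W V.
          ext_relations (ext_of V W z) A B (v, 0) (0, 1) \<delta>1 \<delta>2 \<alpha> \<beta> \<phi> \<eta> [:[:s:]:] 0 [:s:] \<longrightarrow>
          extension R V W (ext_of V W z) ext_in snd \<and>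
          \<not> trivial_extension V W (ext_of V W z) ext_in snd)"
    proof (intro allI impI conjI ballI)
      fix s :: complex
      show "\<exists>!z. z \<in> cocycles R W V \<and>
          ext_relations (ext_of V W z) A B (v, 0) (0, 1) \<delta>1 \<delta>2 \<alpha> \<beta> \<phi> \<eta> [:[:s:]:] 0 [:s:]"
      proof (rule ex1I[of _ "cochain_scale V s u"])
        fix z assume "z \<in> cocycles R W V \<and>
          ext_relations (ext_of V W z) A B (v, 0) (0, 1) \<delta>1 \<delta>2 \<alpha> \<beta> \<phi> \<eta> [:[:s:]:] 0 [:s:]"
        then have "z \<in> cocycles R W V" "fst z 1 = fst (cochain_scale V s u) 1"
          by (auto simp: normal su(2))
        then show "z = cochain_scale V s u" by (intro cocycle_eqI su(1))
      qed (simp add: normal su)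
      fix z assume s: "s \<noteq> 0" and z: "z \<in> cocycles R W V"
        and "ext_relations (ext_of V W z) A B (v, 0) (0, 1) \<delta>1 \<delta>2 \<alpha> \<beta> \<phi> \<eta> [:[:s:]:] 0 [:s:]"
      then have "fst z 1 = scl V s v" by (simp add: normal)
      show "extension R V W (ext_of V W z) ext_in snd" by (rule extension_ext_of[OF z])
      from trivial_extension_iff_ev[OF this z _ ext_of_lift] s \<open>fst z 1 = scl V s v\<close>
      show "\<not> trivial_extension V W (ext_of V W z) ext_in snd" by simp
    qed
    show "\<forall>(E :: ('r, 'e) cmod) \<iota> \<pi>.
        extension R V W E \<iota> \<pi> \<and> \<not> trivial_extension V W E \<iota> \<pi> \<longrightarrow>
        (\<exists>s. s \<noteq> 0 \<and> (\<exists>z \<in> cocycles R W V.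
          ext_relations (ext_of V W z) A B (v, 0) (0, 1) \<delta>1 \<delta>2 \<alpha> \<beta> \<phi> \<eta> [:[:s:]:] 0 [:s:] \<and>
          ext_equivalent E \<iota> \<pi> (ext_of V W z) ext_in snd))"
    proof (intro allI impI, elim conjE)
      fix E :: "('r, 'e) cmod" and \<iota> \<pi>
      assume E: "extension R V W E \<iota> \<pi>" "\<not> trivial_extension V W E \<iota> \<pi>"
      obtain y c where y: "y \<in> cocycles R W V" and c: "\<pi> c = 1" "der E c = scl E \<eta> c + \<iota> (fst y 1)"
        and nz: "ev \<eta> (fst y 1) \<noteq> 0"
        using class_of[OF E(1)] E(2) by blast
      show "\<exists>s. s \<noteq> 0 \<and> (\<exists>z \<in> cocycles R W V.
          ext_relations (ext_of V W z) A B (v, 0) (0, 1) \<delta>1 \<delta>2 \<alpha> \<beta> \<phi> \<eta> [:[:s:]:] 0 [:s:] \<and>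
          ext_equivalent E \<iota> \<pi> (ext_of V W z) ext_in snd)"
        using nz su ext_equivalent_iff_ev[OF E(1) y su(1) c]
        by (intro exI[of _ "ev \<eta> (fst y 1)"] conjI bexI[of _ "cochain_scale V (ev \<eta> (fst y 1)) u"])
          (simp_all add: normal)
    qed
    show "\<forall>y \<in> cocycles R W V - trivial_cocycles R W V. \<forall>z \<in> cocycles R W V - trivial_cocycles R W V.
        \<exists>k. k \<noteq> 0 \<and> ext_equivalent (ext_of V W z) ext_in snd
          (ext_of V W (cochain_scale V k y)) ext_in snd"
    proof (intro ballI)
      fix y z
      assume "y \<in> cocycles R W V - trivial_cocycles R W V"
        and "z \<in> cocycles R W V - trivial_cocycles R W V"
      then have yz: "y \<in> cocycles R W V" "ev \<eta> (fst y 1) \<noteq> 0" "z \<in> cocycles R W V" "ev \<eta> (fst z 1) \<noteq> 0"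
        by (simp_all add: trivial_cocycles_eq)
      let ?k = "ev \<eta> (fst z 1) / ev \<eta> (fst y 1)"
      have "ev \<eta> (fst (cochain_scale V ?k y) 1) = ev \<eta> (fst z 1)"
        using yz(2) by (simp add: cochain_scale_def)
      then show "\<exists>k. k \<noteq> 0 \<and> ext_equivalent (ext_of V W z) ext_in snd
          (ext_of V W (cochain_scale V k y)) ext_in snd"
        using yz cocycle_scale[OF yz(1), of ?k]
        by (intro exI[of _ ?k]) (simp add: ext_of_equivalent_iff_ev)
    qed
  qed (use necessary extension_normal_form in blast)+
qed

end
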